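(* Let $T>0$, $A\ge 0$, and let $b:\mathbb{R}\times(-\infty,T]\to\mathbb{R}$ be a continuous function $b(y,t)$, differentiable in $y$ with $\partial b/\partial y$ continuous in $(y,t)$, satisfying $\sup\{|\partial b(y,t)/\partial y| : y\in\mathbb{R},\ t\le T\}\le A$. Let $\varepsilon>0$ and let $q_\varepsilon$ be the function defined in the context. Then for all $x,y\in\mathbb{R}$, $t<T$, $$\left|\frac{\partial q_\varepsilon}{\partial x}(x,y,t)\right|\le\left[1+(T-t)A\right]\left[\frac{2q_\varepsilon(x,y,t)}{T-t}\right]^{1/2},$$ $$\left|\frac{\partial q_\varepsilon}{\partial y}(x,y,t)\right|\le\left[1+(T-t)A\right]\left[\frac{2q_\varepsilon(x,y,t)}{T-t}\right]^{1/2}.$$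
   Context: Let $Y_\varepsilon$ be the solution of $dY_\varepsilon(s)=b(Y_\varepsilon(s),s)\,ds+\sqrt{\varepsilon}\,dW(s)$, $t\le s\le T$, with $W$ Brownian motion. For $x,y\in\mathbb{R}$, $t<T$ put $u_\varepsilon(x,y,t)=P(Y_\varepsilon(T)>x \mid Y_\varepsilon(t)=y)$ (equivalently, $u_\varepsilon$ is the bounded solution of $\partial_t u_\varepsilon+b(y,t)\partial_y u_\varepsilon+\frac{\varepsilon}{2}\partial_y^2u_\varepsilon=0$, $t<T$, with terminal limit $0$ for $y<x$ and $1$ for $y>x$), and define $q_\varepsilon$ by $u_\varepsilon(x,y,t)=\exp[-q_\varepsilon(x,y,t)/\varepsilon]$; it is positive and differentiable in $x$ and $y$. *)

theory Defs
  imports "HOL-Probability.Probability"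
begin

text \<open>
  Brownian motion on a time set \<open>I\<close>.  The value at the initial time is not normalised to zero:
  only the increments of \<open>W\<close> enter the stochastic differential equation below.
\<close>

definition brownian_motion_on ::
  "'a measure \<Rightarrow> real set \<Rightarrow> (real \<Rightarrow> 'a \<Rightarrow> real) \<Rightarrow> bool"
  where
  "brownian_motion_on M I W \<longleftrightarrow>
     prob_space M \<and>
     (\<forall>s\<in>I. W s \<in> borel_measurable M) \<and>
     (AE \<omega> in M. continuous_on I (\<lambda>s. W s \<omega>)) \<and>
     (\<forall>r\<in>I. \<forall>s\<in>I. r < s \<longrightarrow>
        distributed M lborel (\<lambda>\<omega>. W s \<omega> - W r \<omega>) (normal_density 0 (sqrt (s - r)))) \<and>
     (\<forall>(n::nat) \<tau>. (\<forall>i\<le>n. \<tau> i \<in> I) \<and> (\<forall>i<n. \<tau> i < \<tau> (Suc i)) \<longrightarrow>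
        prob_space.indep_vars M (\<lambda>_. borel) (\<lambda>i \<omega>. W (\<tau> (Suc i)) \<omega> - W (\<tau> i) \<omega>) {..<n})"

text \<open>
  \<open>Z\<close> solves \<open>dZ(s) = b(Z(s),s) ds + sqrt \<epsilon> dW(s)\<close> for \<open>t \<le> s \<le> T\<close> with \<open>Z(t) = y\<close>.  The noise
  is additive, so the equation is the pathwise integral equation and no stochastic integral is
  needed.  Adaptedness of \<open>Z\<close> is not demanded: for drifts Lipschitz in the state variable the
  pathwise solution is unique and hence automatically a functional of the increments of \<open>W\<close>.
\<close>

definition sde_solution ::
  "'a measure \<Rightarrow> (real \<Rightarrow> 'a \<Rightarrow> real) \<Rightarrow> (real \<Rightarrow> real \<Rightarrow> real) \<Rightarrow> real \<Rightarrow> real \<Rightarrow> real \<Rightarrow> real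
    \<Rightarrow> (real \<Rightarrow> 'a \<Rightarrow> real) \<Rightarrow> bool"
  where
  "sde_solution M W b \<epsilon> t T y Z \<longleftrightarrow>
     (\<forall>s\<in>{t..T}. Z s \<in> borel_measurable M) \<and>
     (AE \<omega> in M. continuous_on {t..T} (\<lambda>s. Z s \<omega>) \<and>
        (\<forall>s\<in>{t..T}. Z s \<omega> =
           y + integral {t..s} (\<lambda>r. b (Z r \<omega>) r) + sqrt \<epsilon> * (W s \<omega> - W t \<omega>)))"

text \<open>
  \<open>Y y\<close> is the solution started from \<open>y\<close> at the initial time \<open>t\<close>, so \<open>u_eps M Y T x y\<close> is
  \<open>P(Y(T) > x | Y(t) = y)\<close>; the initial time enters only through \<open>Y\<close>.
\<close>

definition u_eps ::
  "'a measure \<Rightarrow> (real \<Rightarrow> real \<Rightarrow> 'a \<Rightarrow> real) \<Rightarrow> real \<Rightarrow> real \<Rightarrow> real \<Rightarrow> real"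
  where "u_eps M Y T x y = measure M {\<omega> \<in> space M. Y y T \<omega> > x}"

text \<open>The solution \<open>q\<close> of \<open>u = exp (- q / \<epsilon>)\<close>, for \<open>u > 0\<close>.\<close>

definition q_eps ::
  "'a measure \<Rightarrow> (real \<Rightarrow> real \<Rightarrow> 'a \<Rightarrow> real) \<Rightarrow> real \<Rightarrow> real \<Rightarrow> real \<Rightarrow> real \<Rightarrow> real"
  where "q_eps M Y T \<epsilon> x y = - \<epsilon> * ln (u_eps M Y T x y)"

end

theory Submission
  imports Defs
begin

text \<open>
  Write \<tau> = T - t and \<xi> = W(T) - W(t).  The noise is additive, so for a fixed Brownian path the
  equation is a deterministic integral equation, and it can be compared with the same equation
  driven by the tilted path W(s) + c (s - t).  Everything rests on two facts about such tilts.

  The first is probabilistic.  By the Cameron-Martin formula, replacing W by the tilted path and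
  inserting the density exp (- c \<xi> - c^2 \<tau> / 2) leaves expectations of functionals of the path
  unchanged
    (\<open>exceedance_girsanov\<close>).  For a tilt along a line this needs no stochastic calculus: on a uniform
  grid it is a simultaneous translation of independent Gaussian increments
  (\<open>independent_gaussian_shift\<close>), and Bernstein polynomials recover a continuous path from its
  values on grids.

  The second is deterministic.  The difference of two solutions solves a scalar linear equation, so
  the terminal value has explicit increments in the starting point y and the tilt c
  (\<open>tilted_terminal_increment\<close>).  Hence it exceeds x exactly when c exceeds a level C(x,y), where C
  is differentiable and K-Lipschitz for the l1 distance, with K = (1 + \<tau> A) / (\<tau> sqrt \<epsilon>)
  (\<open>implicit_level\<close>).  The constant comes from bounding the integral of exp (- A s) over [0, \<tau>]
  below by \<tau> / (1 + \<tau> A), which amounts to 1 + z \<le> exp z.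

  Let u(x,y) be the probability that the terminal value exceeds x.

  Smoothness and positivity: averaging the Cameron-Martin identity over c with Gaussian weights turns
  u(x,y) into the expectation of a Gaussian tail integral that starts at C(x,y).  This integrand is
  positive, and it inherits differentiability from C, with an integrable Lipschitz constant
  (\<open>exceedance_differentiable\<close>, \<open>exceedance_pos\<close>).

  The bound: let d be the l1 distance of (x',y') from (x,y), put k = K d, and let E be the event that
  the terminal value started at y exceeds x.  The Lipschitz property of C and a tilt by - k give
  u(x',y') \<le> E[exp (k \<xi> - k^2 \<tau> / 2); E].  Hoelder's inequality with exponent p bounds the logarithm
  of the right-hand side by (1 - 1/p) ln u + (p - 1) k^2 \<tau> / 2 (\<open>ln_exceedance_increment\<close>).  The choice
  p = sqrt (2 L / \<tau>) / k with L = - ln u(x,y) gives ln u(x',y') - ln u(x,y) \<le> K d sqrt (2 \<tau> L)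
  (\<open>ln_exceedance_lipschitz\<close>).  Since q = \<epsilon> L, division by d yields the estimate, for both partial
  derivatives at once.
\<close>

section \<open>Exponential averages and a scalar linear equation\<close>

text \<open>
  With z = A (T - t) > 0 both integrals equal (1 - exp (- z)) / A, and the claim becomes
  z \<le> (1 + z) (1 - exp (- z)), that is 1 + z \<le> exp z.  The first form controls how the tilt has to
  react to a change of the starting point, the second how it has to react to a change of the level.
\<close>

lemma integral_exp_decay_ge:
  fixes A t T :: real
  assumes "t < T" "A \<ge> 0"
  shows "(T - t) / (1 + (T - t) * A) \<le> integral {t..T} (\<lambda>s. exp (- (A * (s - t))))"
    and "(T - t) / (1 + (T - t) * A) \<le> integral {t..T} (\<lambda>s. exp (- (A * (T - s))))"
proof -
  have D: "(T - t) / (1 + (T - t) * A) \<le> (1 - exp (- (A * (T - t)))) / A" if "A > 0"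
  proof -
    define z where "z = A * (T - t)"
    have z: "z > 0" using that assms by (simp add: z_def)
    have "(1 + z) * exp (- z) \<le> exp z * exp (- z)"
      by (intro mult_right_mono exp_ge_add_one_self) auto
    hence "z \<le> (1 + z) * (1 - exp (- z))" by (simp add: algebra_simps flip: exp_add)
    hence "z / (1 + z) \<le> 1 - exp (- z)" using z by (simp add: divide_simps mult.commute)
    hence "z / (1 + z) / A \<le> (1 - exp (- z)) / A" by (rule divide_right_mono) (use that in simp)
    thus ?thesis using that by (simp add: z_def mult.commute[of A])
  qed
  show "(T - t) / (1 + (T - t) * A) \<le> integral {t..T} (\<lambda>s. exp (- (A * (s - t))))"
  proof (cases "A = 0")
    case True thus ?thesis using assms by simp
  next
    case False
    have "((\<lambda>s. exp (- (A * (s - t)))) has_integral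
       (- exp (- (A * (T - t))) / A - - exp (- (A * (t - t))) / A)) {t..T}"
      using False assms
      by (intro fundamental_theorem_of_calculus)
         (auto intro!: derivative_eq_intros simp flip: has_real_derivative_iff_has_vector_derivative)
    from integral_unique[OF this] show ?thesis using D False assms by (simp add: diff_divide_distrib)
  qed
  show "(T - t) / (1 + (T - t) * A) \<le> integral {t..T} (\<lambda>s. exp (- (A * (T - s))))"
  proof (cases "A = 0")
    case True thus ?thesis using assms by simp
  next
    case False
    have "((\<lambda>s. exp (- (A * (T - s)))) has_integral
       (exp (- (A * (T - T))) / A - exp (- (A * (T - t))) / A)) {t..T}"
      using False assms
      by (intro fundamental_theorem_of_calculus)
         (auto intro!: derivative_eq_intros simp flip: has_real_derivative_iff_has_vector_derivative)
    from integral_unique[OF this] show ?thesis using D False assms by (simp add: diff_divide_distrib)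
  qed
qed

text \<open>
  Variation of constants: the integrating factor turns the equation for F into an exact derivative.
\<close>

lemma linear_ode_formula:
  fixes \<beta> f F :: "real \<Rightarrow> real"
  assumes \<beta>: "continuous_on {t..T} \<beta>"
    and F: "\<And>s. s \<in> {t..T} \<Longrightarrow> (F has_real_derivative \<beta> s * F s + f s) (at s within {t..T})"
    and s: "s \<in> {t..T}"
  shows "F s * exp (- integral {t..s} \<beta>)
    = F t + integral {t..s} (\<lambda>r. f r * exp (- integral {t..r} \<beta>))"
proof -
  have "((\<lambda>r. f r * exp (- integral {t..r} \<beta>)) has_integral
    (F s * exp (- integral {t..s} \<beta>) - F t * exp (- integral {t..t} \<beta>))) {t..s}"
  proof (rule fundamental_theorem_of_calculus)
    fix r assume r: "r \<in> {t..s}"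
    have r': "r \<in> {t..T}" using r s by auto
    have "((\<lambda>r. F r * exp (- integral {t..r} \<beta>)) has_real_derivative f r * exp (- integral {t..r} \<beta>))
       (at r within {t..T})"
      by (rule derivative_eq_intros F[OF r'] integral_has_real_derivative[OF \<beta> r'] refl)+
         (simp add: algebra_simps)
    thus "((\<lambda>r. F r * exp (- integral {t..r} \<beta>)) has_vector_derivative f r * exp (- integral {t..r} \<beta>))
       (at r within {t..s})"
      using s by (auto simp flip: has_real_derivative_iff_has_vector_derivative
          intro: has_field_derivative_subset)
  qed (use s in auto)
  from integral_unique[OF this] show ?thesis by simp
qed

section \<open>The pathwise integral equation\<close>

locale lipschitz_drift =
  fixes b :: "real \<Rightarrow> real \<Rightarrow> real" and t T A :: real
  assumes t_less_T: "t < T" and A_nonneg: "A \<ge> 0"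
    and b_cont: "continuous_on (UNIV \<times> {t..T}) (\<lambda>(z, s). b z s)"
    and b_diff: "\<And>z s. s \<in> {t..T} \<Longrightarrow> (\<lambda>\<zeta>. b \<zeta> s) differentiable (at z)"
    and b'_cont: "continuous_on (UNIV \<times> {t..T}) (\<lambda>(z, s). deriv (\<lambda>\<zeta>. b \<zeta> s) z)"
    and b'_bound: "\<And>z s. s \<in> {t..T} \<Longrightarrow> \<bar>deriv (\<lambda>\<zeta>. b \<zeta> s) z\<bar> \<le> A"
begin

definition b' where "b' z s = deriv (\<lambda>\<zeta>. b \<zeta> s) z"

text \<open>
  The difference quotient of \<open>b\<close> between \<open>p\<close> and \<open>q\<close>, written as an average of the derivative so that
  it stays continuous across \<open>p = q\<close>.
\<close>

definition mean_slope :: "real \<Rightarrow> real \<Rightarrow> real \<Rightarrow> real"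
  where "mean_slope p q s = integral {0..1} (\<lambda>\<theta>. b' (p + \<theta> * (q - p)) s)"

lemma b_deriv: "s \<in> {t..T} \<Longrightarrow> ((\<lambda>\<zeta>. b \<zeta> s) has_real_derivative b' z s) (at z)"
  using b_diff[of s z] unfolding b'_def
  by (simp add: DERIV_deriv_iff_real_differentiable)

lemma continuous_on_b' [continuous_intros]:
  assumes "continuous_on S f" "continuous_on S g" "\<And>x. x \<in> S \<Longrightarrow> g x \<in> {t..T}"
  shows "continuous_on S (\<lambda>x. b' (f x) (g x))"
  using continuous_on_compose2[OF b'_cont continuous_on_Pair[OF assms(1,2)]] assms(3)
  by (auto simp: b'_def image_subset_iff)

lemma continuous_on_b [continuous_intros]:
  assumes "continuous_on S f" "continuous_on S g" "\<And>x. x \<in> S \<Longrightarrow> g x \<in> {t..T}"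
  shows "continuous_on S (\<lambda>x. b (f x) (g x))"
  using continuous_on_compose2[OF b_cont continuous_on_Pair[OF assms(1,2)]] assms(3)
  by (auto simp: image_subset_iff)

lemma mean_slope: "s \<in> {t..T} \<Longrightarrow> mean_slope p q s * (q - p) = b q s - b p s"
proof -
  assume s: "s \<in> {t..T}"
  have "((\<lambda>\<theta>. b' (p + \<theta> * (q - p)) s * (q - p)) has_integral
     (b (p + 1 * (q - p)) s - b (p + 0 * (q - p)) s)) {0..1}"
  proof (rule fundamental_theorem_of_calculus)
    fix \<theta> :: real
    have "((\<lambda>\<theta>. b (p + \<theta> * (q - p)) s) has_real_derivative b' (p + \<theta> * (q - p)) s * (q - p)) (at \<theta>)"
      by (rule DERIV_chain2[OF b_deriv[OF s]]) (auto intro!: derivative_eq_intros)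
    thus "((\<lambda>\<theta>. b (p + \<theta> * (q - p)) s) has_vector_derivative b' (p + \<theta> * (q - p)) s * (q - p))
       (at \<theta> within {0..1})"
      by (auto simp flip: has_real_derivative_iff_has_vector_derivative
          intro: has_field_derivative_at_within)
  qed simp
  from integral_unique[OF this] show ?thesis by (simp add: mean_slope_def)
qed

lemma mean_slope_bound: "s \<in> {t..T} \<Longrightarrow> \<bar>mean_slope p q s\<bar> \<le> A"
proof -
  assume s: "s \<in> {t..T}"
  have "norm (mean_slope p q s) \<le> A * (1 - 0)"
    unfolding mean_slope_def
    using s A_nonneg b'_bound by (intro integral_bound)
      (auto intro!: continuous_intros simp: b'_def[symmetric] b'_bound)
  thus ?thesis by simp
qed

lemma b_lipschitz: "s \<in> {t..T} \<Longrightarrow> \<bar>b q s - b p s\<bar> \<le> A * \<bar>q - p\<bar>"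
  by (simp add: mean_slope[symmetric] abs_mult mult_right_mono mean_slope_bound)

lemma continuous_on_mean_slope [continuous_intros]:
  assumes "continuous_on S f" "continuous_on S g" "continuous_on S h" "\<And>x. x \<in> S \<Longrightarrow> h x \<in> {t..T}"
  shows "continuous_on S (\<lambda>x. mean_slope (f x) (g x) (h x))"
proof -
  have "continuous_on (UNIV \<times> UNIV \<times> {t..T})
      (\<lambda>v. integral (cbox 0 1) (\<lambda>\<theta>. b' (fst v + \<theta> * (fst (snd v) - fst v)) (snd (snd v))))"
    by (rule integral_continuous_on_param)
       (auto intro!: continuous_intros simp: split_beta mem_Times_iff)
  from continuous_on_compose2[OF this continuous_on_Pair[OF assms(1) continuous_on_Pair[OF assms(2,3)]]]
  show ?thesis using assms(4) by (auto simp: mean_slope_def image_subset_iff)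
qed

text \<open>
  \<open>w\<close> is the accumulated noise.  No initial condition is imposed on \<open>w\<close>, so \<open>y\<close> is the starting point
  only when \<open>w t = 0\<close>.
\<close>

definition solves :: "real \<Rightarrow> (real \<Rightarrow> real) \<Rightarrow> (real \<Rightarrow> real) \<Rightarrow> bool" where
  "solves y w z \<longleftrightarrow> continuous_on {t..T} z \<and>
     (\<forall>s\<in>{t..T}. z s = y + integral {t..s} (\<lambda>r. b (z r) r) + w s)"

definition slope_integral :: "(real \<Rightarrow> real) \<Rightarrow> (real \<Rightarrow> real) \<Rightarrow> real \<Rightarrow> real" where
  "slope_integral z z' s = integral {t..s} (\<lambda>r. mean_slope (z r) (z' r) r)"

text \<open>
  The difference z' - z of two solutions satisfies a linear equation with coefficient
  \<open>mean_slope\<close>.  The drivers need not be differentiable, so their difference is subtracted, which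
  leaves a differentiable function; a differentiable \<open>g\<close> may be added back.  For \<open>g = 0\<close> the formula
  bounds z' - z by the size of w' - w; for \<open>g = w' - w\<close> it describes z' - z itself.
\<close>

lemma solution_difference:
  assumes z: "solves y w z" and z': "solves y' w' z'" and s: "s \<in> {t..T}"
    and g: "\<And>s. s \<in> {t..T} \<Longrightarrow> (g has_real_derivative g' s) (at s within {t..T})"
  shows "(z' s - z s - (w' s - w s) + g s) * exp (- slope_integral z z' s)
    = y' - y + g t + integral {t..s} (\<lambda>r. (mean_slope (z r) (z' r) r * (w' r - w r - g r)
      + g' r) * exp (- slope_integral z z' r))"
proof -
  let ?F = "\<lambda>s. z' s - z s - (w' s - w s) + g s"
  have cz: "continuous_on {t..T} z" "continuous_on {t..T} z'" using z z' by (auto simp: solves_def)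
  let ?D = "\<lambda>s. y' - y + integral {t..s} (\<lambda>r. b (z' r) r - b (z r) r) + g s"
  have FD: "?F s = ?D s" if s: "s \<in> {t..T}" for s
  proof -
    have "(\<lambda>r. b (z' r) r) integrable_on {t..s}" "(\<lambda>r. b (z r) r) integrable_on {t..s}"
      using s by (auto intro!: integrable_continuous_interval continuous_intros
          intro: continuous_on_subset[OF cz(1)] continuous_on_subset[OF cz(2)])
    thus ?thesis using z z' s by (simp add: solves_def integral_diff)
  qed
  have "(?F has_real_derivative mean_slope (z s) (z' s) s * ?F s
      + (mean_slope (z s) (z' s) s * (w' s - w s - g s) + g' s)) (at s within {t..T})"
    if s: "s \<in> {t..T}" for s
  proof -
    have "(?D has_real_derivative (b (z' s) s - b (z s) s) + g' s) (at s within {t..T})"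
      using s cz by (auto intro!: derivative_eq_intros g integral_has_real_derivative continuous_intros)
    hence "(?F has_real_derivative (b (z' s) s - b (z s) s) + g' s) (at s within {t..T})"
      by (rule has_field_derivative_transform_within[where d=1]) (use s FD in auto)
    moreover have "mean_slope (z s) (z' s) s * ?F s
      + (mean_slope (z s) (z' s) s * (w' s - w s - g s) + g' s) = (b (z' s) s - b (z s) s) + g' s"
      using mean_slope[OF s, of "z s" "z' s"] by (simp add: algebra_simps)
    ultimately show ?thesis by (simp only:)
  qed
  moreover have "continuous_on {t..T} (\<lambda>r. mean_slope (z r) (z' r) r)"
    by (intro continuous_intros cz) auto
  ultimately have "?F s * exp (- slope_integral z z' s) = ?F t + integral {t..s} (\<lambda>r.
    (mean_slope (z r) (z' r) r * (w' r - w r - g r) + g' r) * exp (- slope_integral z z' r))"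
    unfolding slope_integral_def by (rule linear_ode_formula[where F="?F" and s=s, OF _ _ s, rotated])
  also have "?F t = y' - y + g t" using FD[of t] t_less_T by simp
  finally show ?thesis .
qed

lemma slope_integral_continuous:
  assumes "continuous_on {t..T} z" "continuous_on {t..T} z'"
  shows "continuous_on {t..T} (slope_integral z z')"
  unfolding slope_integral_def
  by (intro indefinite_integral_continuous_1 integrable_continuous_interval continuous_intros assms) auto

lemma slope_integral_increment:
  assumes "continuous_on {t..T} z" "continuous_on {t..T} z'" "t \<le> r" "r \<le> s" "s \<le> T"
  shows "\<bar>slope_integral z z' s - slope_integral z z' r\<bar> \<le> A * (s - r)"
proof -
  have c: "continuous_on {t..T} (\<lambda>r. mean_slope (z r) (z' r) r)"
    by (intro continuous_intros assms) auto
  have "slope_integral z z' r + integral {r..s} (\<lambda>r. mean_slope (z r) (z' r) r) = slope_integral z z' s"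
    unfolding slope_integral_def
    by (rule Henstock_Kurzweil_Integration.integral_combine)
       (use assms in \<open>auto intro!: integrable_continuous_interval intro: continuous_on_subset[OF c]\<close>)
  moreover have "norm (integral {r..s} (\<lambda>r. mean_slope (z r) (z' r) r)) \<le> A * (s - r)"
    by (rule integral_bound) (use assms mean_slope_bound in \<open>auto intro: continuous_on_subset[OF c]\<close>)
  ultimately show ?thesis by (auto simp flip: \<open>slope_integral z z' r + _ = _\<close>)
qed

lemma slope_integral_start [simp]: "slope_integral z z' t = 0"
  by (simp add: slope_integral_def)

text \<open>
  Continuous dependence in the supremum norm.  The constant is crude; only its independence of the
  paths matters.
\<close>

lemma solution_stable:
  assumes z: "solves y w z" and z': "solves y' w' z'" and s: "s \<in> {t..T}"
    and w: "continuous_on {t..T} w" "continuous_on {t..T} w'"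
    and \<eta>: "\<And>s. s \<in> {t..T} \<Longrightarrow> \<bar>w' s - w s\<bar> \<le> \<eta>"
  shows "\<bar>z' s - z s\<bar> \<le> (2 + A * (T - t)) * exp (2 * A * (T - t)) * (\<bar>y' - y\<bar> + \<eta>)"
proof -
  let ?P = "slope_integral z z'" and ?E = "exp (A * (T - t))"
  have cz: "continuous_on {t..T} z" "continuous_on {t..T} z'" using z z' by (auto simp: solves_def)
  note cP = slope_integral_continuous[OF cz]
  have P: "\<bar>?P r\<bar> \<le> A * (T - t)" if "r \<in> {t..T}" for r
  proof -
    have "\<bar>?P r - ?P t\<bar> \<le> A * (r - t)" using that by (intro slope_integral_increment cz) auto
    also have "\<dots> \<le> A * (T - t)" using that A_nonneg by (intro mult_left_mono) auto
    finally show ?thesis by simp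
  qed
  have \<eta>0: "\<eta> \<ge> 0" using \<eta>[OF s] by linarith
  let ?f = "\<lambda>r. mean_slope (z r) (z' r) r * (w' r - w r) * exp (- ?P r)"
  have I: "norm (integral {t..s} ?f) \<le> (A * \<eta> * ?E) * (s - t)"
  proof (rule integral_bound)
    show "continuous_on {t..s} ?f"
      by (rule continuous_on_subset[of "{t..T}"]) (use s in \<open>auto intro!: continuous_intros cz w cP\<close>)
    fix r assume "r \<in> {t..s}"
    hence r: "r \<in> {t..T}" using s by auto
    show "norm (?f r) \<le> A * \<eta> * ?E" unfolding norm_mult
      using mean_slope_bound[OF r, of "z r" "z' r"] \<eta>[OF r] P[OF r] A_nonneg \<eta>0
      by (intro mult_mono) auto
  qed (use s in auto)
  have "(z' s - z s - (w' s - w s)) * exp (- ?P s) = y' - y + integral {t..s} ?f"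
    using solution_difference[OF z z' s, of "\<lambda>_. 0" "\<lambda>_. 0"] by simp
  moreover have "u * exp (- p) = v \<Longrightarrow> u = v * exp p" for u v p :: real
    by (auto simp flip: exp_add)
  ultimately have "z' s - z s - (w' s - w s) = (y' - y + integral {t..s} ?f) * exp (?P s)"
    by blast
  hence "\<bar>z' s - z s\<bar> = \<bar>(w' s - w s) + (y' - y + integral {t..s} ?f) * exp (?P s)\<bar>"
    by linarith
  also have "\<dots> \<le> \<bar>w' s - w s\<bar> + (\<bar>y' - y\<bar> + \<bar>integral {t..s} ?f\<bar>) * exp (?P s)"
    by (intro order.trans[OF abs_triangle_ineq] add_mono) (auto simp: abs_mult)
  also have "\<dots> \<le> \<eta> + (\<bar>y' - y\<bar> + (A * \<eta> * ?E) * (T - t)) * ?E"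
  proof (intro add_mono mult_mono)
    have "(A * \<eta> * ?E) * (s - t) \<le> (A * \<eta> * ?E) * (T - t)"
      using s A_nonneg \<eta>0 by (intro mult_left_mono) auto
    thus "\<bar>integral {t..s} ?f\<bar> \<le> (A * \<eta> * ?E) * (T - t)" using I by simp
    show "exp (?P s) \<le> ?E" using P[OF s] by simp
    show "\<bar>w' s - w s\<bar> \<le> \<eta>" by (rule \<eta>[OF s])
  qed (use \<eta>0 A_nonneg t_less_T in auto)
  also have "\<dots> \<le> (2 + A * (T - t)) * exp (2 * A * (T - t)) * (\<bar>y' - y\<bar> + \<eta>)"
  proof -
    have E1: "1 \<le> ?E" using A_nonneg t_less_T by simp
    have EE: "exp (2 * A * (T - t)) = ?E * ?E" by (simp add: algebra_simps flip: exp_add)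
    have "?E * 1 \<le> ?E * ?E" by (rule mult_left_mono[OF E1]) simp
    moreover from this have "1 \<le> ?E * ?E" using E1 by linarith
    ultimately have "\<eta> * 1 \<le> \<eta> * (?E * ?E)" "\<bar>y' - y\<bar> * ?E \<le> \<bar>y' - y\<bar> * (?E * ?E)"
      "0 \<le> (1 + A * (T - t)) * \<bar>y' - y\<bar> * (?E * ?E)" "0 \<le> \<eta> * (?E * ?E)"
      using \<eta>0 A_nonneg t_less_T by (auto intro!: mult_left_mono simp: mult_le_cancel_left1)
    thus ?thesis unfolding EE by (simp add: algebra_simps)
  qed
  finally show ?thesis .
qed

text \<open>
  For drivers that differ by a linear function the increment of the terminal value is exact, and its
  coefficients depend on the solutions only through the integral of \<open>mean_slope\<close>.
\<close>

lemma solution_increment: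
  assumes z: "solves y w z" and z': "solves y' w' z'"
    and a: "\<And>s. s \<in> {t..T} \<Longrightarrow> w' s - w s = a * (s - t)"
  shows "(z' T - z T) * exp (- slope_integral z z' T)
    = y' - y + a * integral {t..T} (\<lambda>s. exp (- slope_integral z z' s))"
proof -
  have "integral {t..T} (\<lambda>r. (mean_slope (z r) (z' r) r * (w' r - w r - a * (r - t)) + a) * exp
    (- slope_integral z z' r))
    = integral {t..T} (\<lambda>r. a * exp (- slope_integral z z' r))"
    by (rule integral_cong) (simp add: a)
  moreover have "((\<lambda>s. a * (s - t)) has_real_derivative a) (at s within {t..T})" for s
    by (auto intro!: derivative_eq_intros)
  ultimately show ?thesis
    using solution_difference[OF z z', of T "\<lambda>s. a * (s - t)" "\<lambda>_. a"] t_less_T a by simp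
qed

text \<open>
  Picard's theorem on the whole interval at once: in the norm weighted with \<open>exp (- l (s - t))\<close>,
  \<open>l = 2 A + 1\<close>, the integral operator is a contraction with factor 1/2.  The Banach space at hand
  consists of bounded continuous functions on the real line, so time is clamped to \<open>[t, T]\<close>.
\<close>

lemma solution_exists:
  assumes w: "continuous_on {t..T} w"
  shows "\<exists>z. solves y w z"
proof -
  define l where "l = 2 * A + 1"
  have l: "l > 0" "A / l \<le> 1 / 2" using A_nonneg by (auto simp: l_def field_simps)
  define cl where "cl s = max t (min T s)" for s
  have cl: "cl s \<in> {t..T}" for s using t_less_T by (auto simp: cl_def)
  have cl_id: "cl s = s" if "s \<in> {t..T}" for s using that by (auto simp: cl_def)
  have cl_cont: "continuous_on UNIV cl" unfolding cl_def by (intro continuous_intros)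
  \<comment> \<open>\<open>zz g\<close> undoes the weight: the fixed point \<open>g\<close> is the solution multiplied by \<open>exp (- l (s - t))\<close>.\<close>
  define zz where "zz g s = exp (l * (s - t)) * apply_bcontfun g s" for g :: "real \<Rightarrow>\<^sub>C real" and s
  have cz: "continuous_on S (zz g)" for S g
    unfolding zz_def by
      (intro continuous_intros continuous_on_subset[OF continuous_on_apply_bcontfun]) auto
  have bz: "continuous_on {t..s} (\<lambda>r. b (zz g r) r)" if "s \<le> T" for g s
    using that by (intro continuous_intros cz) auto
  define H where "H g s = exp (- (l * (s - t))) * (y + integral {t..s} (\<lambda>r. b (zz g r) r)
    + w s)" for g s
  have cH: "continuous_on {t..T} (H g)" for g
    unfolding H_def
    by (intro continuous_intros indefinite_integral_continuous_1 integrable_continuous_interval bz w) auto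
  have "(\<lambda>s. H g (cl s)) \<in> bcontfun" for g
  proof -
    have "continuous_on UNIV (\<lambda>s. H g (cl s))"
      by (rule continuous_on_compose2[OF cH cl_cont]) (use cl in auto)
    moreover have "bounded (range (\<lambda>s. H g (cl s)))"
      by (rule bounded_subset[OF compact_imp_bounded[OF compact_continuous_image[OF cH]]])
         (use cl in auto)
    ultimately show ?thesis by (auto simp: bcontfun_def)
  qed
  hence G: "apply_bcontfun (Bcontfun (\<lambda>s. H g (cl s))) s = H g (cl s)" for g s
    by (simp add: Bcontfun_inverse)
  define G where "G g = Bcontfun (\<lambda>s. H g (cl s))" for g
  have contr: "\<forall>g h. dist (G g) (G h) \<le> (1/2) * dist g h"
  proof (intro allI, rule dist_bound)
    fix g h :: "real \<Rightarrow>\<^sub>C real" and s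
    define p where "p = cl s"
    have p: "p \<in> {t..T}" using cl by (simp add: p_def)
    define d where "d = dist g h"
    have d: "\<bar>zz g r - zz h r\<bar> \<le> exp (l * (r - t)) * d" for r
      using dist_bounded[of g r h] by
        (simp add: zz_def d_def dist_real_def abs_mult flip: right_diff_distrib)
    have i: "((\<lambda>r. A * (exp (l * (r - t)) * d)) has_integral
      (A * d / l * exp (l * (p - t)) - A * d / l * exp (l * (t - t)))) {t..p}"
      using p l by (intro fundamental_theorem_of_calculus)
        (auto intro!: derivative_eq_intros simp flip: has_real_derivative_iff_has_vector_derivative)
    have "norm (integral {t..p} (\<lambda>r. b (zz g r) r - b (zz h r) r))
      \<le> integral {t..p} (\<lambda>r. A * (exp (l * (r - t)) * d))"
    proof (rule integral_norm_bound_integral)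
      fix r assume "r \<in> {t..p}"
      hence r: "r \<in> {t..T}" using p by auto
      show "norm (b (zz g r) r - b (zz h r) r) \<le> A * (exp (l * (r - t)) * d)"
        using b_lipschitz[OF r, of "zz g r" "zz h r"] mult_left_mono[OF d A_nonneg, of r] by simp
    qed (use p i in \<open>auto intro!: integrable_continuous_interval continuous_on_diff bz continuous_intros\<close>)
    also have "\<dots> = A * d / l * (exp (l * (p - t)) - 1)"
      using integral_unique[OF i] by (simp add: algebra_simps)
    also have "\<dots> \<le> A * d / l * exp (l * (p - t))"
      using A_nonneg l by (intro mult_left_mono) (auto simp: d_def)
    finally have I: "\<bar>integral {t..p} (\<lambda>r. b (zz g r) r - b (zz h r) r)\<bar> \<le> A * d / l * exp (l
      * (p - t))"
      by simp
    have "integral {t..p} (\<lambda>r. b (zz g r) r - b (zz h r) r)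
      = integral {t..p} (\<lambda>r. b (zz g r) r) - integral {t..p} (\<lambda>r. b (zz h r) r)"
      using p by (intro integral_diff integrable_continuous_interval bz) auto
    hence "H g p - H h p = exp (- (l * (p - t))) * integral {t..p} (\<lambda>r. b (zz g r) r - b (zz h r) r)"
      by (simp add: H_def flip: right_diff_distrib)
    hence "\<bar>H g p - H h p\<bar> = exp (- (l * (p - t))) * \<bar>integral {t..p} (\<lambda>r. b (zz g r) r - b
      (zz h r) r)\<bar>"
      by (simp add: abs_mult)
    also have "\<dots> \<le> exp (- (l * (p - t))) * (A * d / l * exp (l * (p - t)))"
      by (intro mult_left_mono I) auto
    also have "\<dots> = A / l * d" by (simp add: exp_minus)
    also have "\<dots> \<le> 1/2 * d" using l(2) by (intro mult_right_mono) (auto simp: d_def)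
    finally show "dist (apply_bcontfun (G g) s) (apply_bcontfun (G h) s) \<le> 1 / 2 * dist g h"
      by (simp add: G_def G p_def d_def dist_real_def)
  qed
  obtain g where "G g = g" using banach_fix_type[of "1/2" G] contr by auto
  hence g: "apply_bcontfun g s = H g s" if "s \<in> {t..T}" for s
    using G[of g s] that by (simp add: G_def cl_id)
  have "zz g s = y + integral {t..s} (\<lambda>r. b (zz g r) r) + w s" if "s \<in> {t..T}" for s
  proof -
    have "zz g s = exp (l * (s - t)) * H g s" using g[OF that] by (simp add: zz_def)
    thus ?thesis by (simp add: H_def exp_minus)
  qed
  hence "solves y w (zz g)" using cz by (simp add: solves_def)
  thus ?thesis by blast
qed

text \<open>
  The choice is harmless: solutions exist for continuous drivers and are unique.
\<close>

definition terminal :: "real \<Rightarrow> (real \<Rightarrow> real) \<Rightarrow> real"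
  where "terminal y w = (SOME z. solves y w z) T"

definition stability :: real
  where "stability = (2 + A * (T - t)) * exp (2 * A * (T - t))"

lemma stability_nonneg: "stability \<ge> 0"
  using A_nonneg t_less_T by (simp add: stability_def)

lemma terminal_lipschitz:
  assumes w: "continuous_on {t..T} w" "continuous_on {t..T} w'"
    and "\<And>s. s \<in> {t..T} \<Longrightarrow> \<bar>w' s - w s\<bar> \<le> \<eta>"
  shows "\<bar>terminal y' w' - terminal y w\<bar> \<le> stability * (\<bar>y' - y\<bar> + \<eta>)"
  unfolding terminal_def stability_def
  using solution_stable[OF someI_ex[OF solution_exists] someI_ex[OF solution_exists], OF w(1,2) _ w] assms(3) t_less_T
  by auto

lemma terminal_eq:
  assumes "solves y w z" "continuous_on {t..T} w"
  shows "terminal y w = z T"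
  using solution_stable[OF assms(1) someI_ex[OF solution_exists[where y=y]], OF assms(2) _ assms(2) assms(2), of T 0] t_less_T
  by (simp add: terminal_def)

subsection \<open>Sampled drivers and measurable dependence on the path\<close>

definition node :: "nat \<Rightarrow> nat \<Rightarrow> real"
  where "node n k = t + (T - t) * (k / n)"

definition bernstein_path :: "nat \<Rightarrow> (nat \<Rightarrow> real) \<Rightarrow> real \<Rightarrow> real"
  where "bernstein_path n a s = (\<Sum>k\<le>n. a k * Bernstein n k ((s - t) / (T - t)))"

lemma bernstein_path_cong:
  "(\<And>k. k \<le> n \<Longrightarrow> a k = a' k) \<Longrightarrow> bernstein_path n a = bernstein_path n a'"
  by (auto simp: bernstein_path_def fun_eq_iff intro!: sum.cong)

lemma node_in: "k \<le> n \<Longrightarrow> n > 0 \<Longrightarrow> node n k \<in> {t..T}"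
  using t_less_T mult_left_mono[of "real k / real n" 1 "T - t"] by (auto simp: node_def)

lemma bernstein_path_continuous: "continuous_on S (bernstein_path n a)"
  unfolding bernstein_path_def Bernstein_def by (intro continuous_intros) (use t_less_T in auto)

lemma bernstein_path_diff:
  assumes "s \<in> {t..T}"
  shows "\<bar>bernstein_path n a' s - bernstein_path n a s\<bar> \<le> (\<Sum>k\<le>n. \<bar>a' k - a k\<bar>)"
proof -
  let ?v = "(s - t) / (T - t)"
  have v: "0 \<le> ?v" "?v \<le> 1" using assms t_less_T by auto
  have B1: "Bernstein n k ?v \<le> 1" if "k \<le> n" for k
    using member_le_sum[of k "{..n}" "\<lambda>k. Bernstein n k ?v"] Bernstein_nonneg[OF v] that by simp
  have "bernstein_path n a' s - bernstein_path n a s = (\<Sum>k\<le>n. (a' k - a k) * Bernstein n k ?v)"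
    by (simp add: bernstein_path_def left_diff_distrib sum_subtractf)
  also have "\<bar>\<dots>\<bar> \<le> (\<Sum>k\<le>n. \<bar>(a' k - a k) * Bernstein n k ?v\<bar>)" by (rule sum_abs)
  also have "\<dots> \<le> (\<Sum>k\<le>n. \<bar>a' k - a k\<bar>)"
    using B1 Bernstein_nonneg[OF v] by (intro sum_mono) (auto simp: abs_mult intro: mult_left_le)
  finally show ?thesis .
qed

text \<open>
  A driver built from finitely many samples gives a terminal value that is a continuous function of
  the sample vector, hence a random variable when the samples are.
\<close>

lemma terminal_bernstein_measurable:
  assumes X: "\<And>k. k \<le> n \<Longrightarrow> X k \<in> borel_measurable N"
  shows "(\<lambda>\<omega>. terminal y (bernstein_path n (\<lambda>k. X k \<omega>))) \<in> borel_measurable N"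
proof -
  let ?\<Psi> = "\<lambda>a. terminal y (bernstein_path n a)"
  have "continuous_on UNIV ?\<Psi>"
    unfolding continuous_on_def
  proof
    fix a :: "nat \<Rightarrow> real"
    have "continuous_on UNIV (\<lambda>a'. stability * (\<Sum>k\<le>n. \<bar>a' k - a k\<bar>))"
      by (intro continuous_intros continuous_on_product_coordinates)
    hence "((\<lambda>a'. stability * (\<Sum>k\<le>n. \<bar>a' k - a k\<bar>)) \<longlongrightarrow> stability * (\<Sum>k\<le>n. \<bar>a k - a k\<bar>)) (at a)"
      unfolding continuous_on_def by (rule bspec) simp
    hence lim: "((\<lambda>a'. stability * (\<Sum>k\<le>n. \<bar>a' k - a k\<bar>)) \<longlongrightarrow> 0) (at a)" by simp
    have "\<bar>?\<Psi> a' - ?\<Psi> a\<bar> \<le> stability * (\<bar>y - y\<bar> + (\<Sum>k\<le>n. \<bar>a' k - a k\<bar>))" for a'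
      by (intro terminal_lipschitz bernstein_path_continuous bernstein_path_diff)
    hence "((\<lambda>a'. ?\<Psi> a' - ?\<Psi> a) \<longlongrightarrow> 0) (at a)"
      by (intro Lim_null_comparison[OF always_eventually lim]) simp
    thus "(?\<Psi> \<longlongrightarrow> ?\<Psi> a) (at a)" by (simp add: LIM_zero_iff)
  qed
  hence \<Psi>: "?\<Psi> \<in> borel_measurable borel" by (rule borel_measurable_continuous_onI)
  \<comment> \<open>The vector of samples is completed by zeros to a point of the space of all sequences.\<close>
  have X': "(\<lambda>\<omega> k. if k \<le> n then X k \<omega> else 0) \<in> borel_measurable N"
  proof (rule measurable_coordinatewise_then_product)
    show "(\<lambda>\<omega>. if k \<le> n then X k \<omega> else 0) \<in> borel_measurable N" for k
      using X by (cases "k \<le> n") auto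
  qed
  have "bernstein_path n (\<lambda>k. if k \<le> n then X k \<omega> else 0) = bernstein_path n (\<lambda>k. X k \<omega>)" for \<omega>
    by (rule bernstein_path_cong) simp
  thus ?thesis using measurable_compose[OF X' \<Psi>] by simp
qed

lemma terminal_bernstein_tendsto:
  assumes w: "continuous_on {t..T} w"
  shows "(\<lambda>n. terminal y (bernstein_path (Suc n) (\<lambda>k. w (node (Suc n) k)))) \<longlonglongrightarrow> terminal y w"
proof (rule LIMSEQ_I)
  fix r :: real assume r: "r > 0"
  define \<eta> where "\<eta> = r / (stability + 1)"
  have \<eta>: "\<eta> > 0" using r stability_nonneg by (simp add: \<eta>_def)
  have "continuous_on {0..1} (\<lambda>v. w (t + (T - t) * v))"
  proof (rule continuous_on_compose2[OF w])
    show "(\<lambda>v. t + (T - t) * v) ` {0..1} \<subseteq> {t..T}"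
    proof safe
      fix v :: real assume "v \<in> {0..1}"
      hence "0 \<le> (T - t) * v" "(T - t) * v \<le> (T - t) * 1"
        using t_less_T by (auto intro!: mult_left_mono simp del: mult_1_right)
      thus "t + (T - t) * v \<in> {t..T}" by simp
    qed
  qed (intro continuous_intros)
  from Bernstein_Weierstrass[OF this \<eta>] obtain N where
    N: "\<And>n v. N \<le> n \<Longrightarrow> v \<in> {0..1} \<Longrightarrow>
      \<bar>w (t + (T - t) * v) - (\<Sum>k\<le>n. w (t + (T - t) * (k / n)) * Bernstein n k v)\<bar> < \<eta>" by blast
  have "norm (terminal y (bernstein_path (Suc n) (\<lambda>k. w (node (Suc n) k))) - terminal y w) < r"
    if "n \<ge> N" for n
  proof -
    let ?p = "bernstein_path (Suc n) (\<lambda>k. w (node (Suc n) k))"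
    have "\<bar>terminal y ?p - terminal y w\<bar> \<le> stability * (\<bar>y - y\<bar> + \<eta>)"
    proof (rule terminal_lipschitz[OF w bernstein_path_continuous])
      fix s assume "s \<in> {t..T}"
      hence "(s - t) / (T - t) \<in> {0..1}" using t_less_T by auto
      from N[OF _ this, of "Suc n"] show "\<bar>?p s - w s\<bar> \<le> \<eta>"
        using that t_less_T by (simp add: bernstein_path_def node_def abs_minus_commute)
    qed
    also have "\<dots> < r" using r stability_nonneg by (simp add: \<eta>_def field_simps)
    finally show ?thesis by simp
  qed
  thus "\<exists>no. \<forall>n\<ge>no. norm (terminal y (bernstein_path (Suc n) (\<lambda>k. w (node
    (Suc n) k))) - terminal y w) < r"
    by blast
qed

text \<open>
  The terminal value as a limit of functions of finitely many samples.  In this form it is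
  measurable in the path without any continuity; on continuous paths it is the terminal value.
\<close>

definition flow :: "real \<Rightarrow> (real \<Rightarrow> real) \<Rightarrow> real"
  where "flow y w = lim (\<lambda>n. terminal y (bernstein_path (Suc n) (\<lambda>k. w (node (Suc n) k))))"

lemma flow_eq_terminal: "continuous_on {t..T} w \<Longrightarrow> flow y w = terminal y w"
  unfolding flow_def by (rule limI[OF terminal_bernstein_tendsto])

lemma flow_measurable:
  assumes "\<And>s. s \<in> {t..T} \<Longrightarrow> (\<lambda>\<omega>. X \<omega> s) \<in> borel_measurable N"
  shows "(\<lambda>\<omega>. flow y (X \<omega>)) \<in> borel_measurable N"
  unfolding flow_def
  by (intro borel_measurable_lim_metric terminal_bernstein_measurable assms node_in) auto

subsection \<open>Dependence on the starting point and on a linear tilt of the driver\<close>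

text \<open>
  Continuity of the coefficients of \<open>solution_increment\<close> when the second solution approaches the
  first, by dominated convergence and continuity of \<open>mean_slope\<close> on the diagonal.
\<close>

lemma slope_integral_tendsto:
  assumes z: "continuous_on {t..T} z" and zn: "\<And>n. continuous_on {t..T} (zn n)"
    and lim: "\<And>s. s \<in> {t..T} \<Longrightarrow> (\<lambda>n. zn n s) \<longlonglongrightarrow> z s"
    and s: "s \<in> {t..T}"
  shows "(\<lambda>n. slope_integral z (zn n) s) \<longlonglongrightarrow> slope_integral z z s"
  unfolding slope_integral_def
proof (rule dominated_convergence(2))
  fix n
  have "continuous_on {t..T} (\<lambda>r. mean_slope (z r) (zn n r) r)"
    by (intro continuous_intros z zn) auto
  thus "(\<lambda>r. mean_slope (z r) (zn n r) r) integrable_on {t..s}"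
    using s by (intro integrable_continuous_interval) (auto intro: continuous_on_subset)
next
  fix r assume "r \<in> {t..s}"
  hence r: "r \<in> {t..T}" using s by auto
  have "continuous_on UNIV (\<lambda>q. mean_slope (z r) q r)"
    by (intro continuous_intros) (use r in auto)
  from continuous_on_tendsto_compose[OF this lim[OF r]]
  show "(\<lambda>n. mean_slope (z r) (zn n r) r) \<longlonglongrightarrow> mean_slope (z r) (z r) r" by simp
next
  show "(\<lambda>_. A) integrable_on {t..s}" by (rule integrable_const_ivl)
  show "norm (mean_slope (z r) (zn n r) r) \<le> A" if "r \<in> {t..s}" for n r
    using mean_slope_bound[of r] that s by auto
qed

text \<open>
  In the application \<open>a\<close> is the noise intensity \<open>sqrt \<epsilon>\<close>, so that \<open>c\<close> tilts the Brownian path itself.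
\<close>

definition tilted_terminal :: "(real \<Rightarrow> real) \<Rightarrow> real \<Rightarrow> real \<Rightarrow> real \<Rightarrow> real"
  where "tilted_terminal w a y c = terminal y (\<lambda>s. w s + a * c * (s - t))"

text \<open>
  Existential form of \<open>solution_increment\<close>, uniform in the two pairs of arguments.  With P the
  integral of \<open>mean_slope\<close> from t, \<open>e\<close> is exp (- P(T)) and \<open>j\<close> is the integral of exp (- P) over
  \<open>[t, T]\<close>.  Since P is A-Lipschitz and vanishes at t, both \<open>j\<close> and \<open>j / e\<close> are bounded below as in
  \<open>integral_exp_decay_ge\<close>; these two bounds control the derivatives in y and in x.
\<close>

lemma tilted_terminal_increment:
  assumes w: "continuous_on {t..T} w"
  obtains e j :: "real \<Rightarrow> real \<Rightarrow> real \<Rightarrow> real \<Rightarrow> real" where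
    "\<And>y c y' c'. (tilted_terminal w a y' c' - tilted_terminal w a y c) * e y c y' c'
        = y' - y + a * (c' - c) * j y c y' c'"
    "\<And>y c y' c'. e y c y' c' > 0"
    "\<And>y c y' c'. (T - t) / (1 + (T - t) * A) \<le> j y c y' c'"
    "\<And>y c y' c'. (T - t) / (1 + (T - t) * A) * e y c y' c' \<le> j y c y' c'"
    "\<And>y c yn cn. yn \<longlonglongrightarrow> y \<Longrightarrow> cn \<longlonglongrightarrow> c \<Longrightarrow> (\<lambda>n. e y c (yn n) (cn n)) \<longlonglongrightarrow> e y c y c"
    "\<And>y c yn cn. yn \<longlonglongrightarrow> y \<Longrightarrow> cn \<longlonglongrightarrow> c \<Longrightarrow> (\<lambda>n. j y c (yn n) (cn n)) \<longlonglongrightarrow> j y c y c"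
proof -
  define d where "d c s = w s + a * c * (s - t)" for c s
  have d: "continuous_on {t..T} (d c)" for c unfolding d_def by (intro continuous_intros w)
  define z where "z y c = (SOME z. solves y (d c) z)" for y c
  have z: "solves y (d c) (z y c)" for y c
    unfolding z_def by (rule someI_ex[OF solution_exists[OF d]])
  have cz: "continuous_on {t..T} (z y c)" for y c using z by (auto simp: solves_def)
  have V: "tilted_terminal w a y c = z y c T" for y c
    using terminal_eq[OF z d] by (simp add: tilted_terminal_def d_def[abs_def])
  define e where "e y c y' c' = exp (- slope_integral (z y c) (z y' c') T)" for y c y' c'
  define j where "j y c y' c' = integral {t..T} (\<lambda>s. exp (- slope_integral (z y c)
    (z y' c') s))" for y c y' c'
  have cP: "continuous_on {t..T} (\<lambda>s. exp (- slope_integral (z y c) (z y' c') s))" for y c y' c'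
    by (intro continuous_intros slope_integral_continuous cz)
  have P: "\<bar>slope_integral (z y c) (z y' c') s - slope_integral (z y c) (z y' c') r\<bar> \<le> A * (s - r)"
    if "t \<le> r" "r \<le> s" "s \<le> T" for y c y' c' r s
    using slope_integral_increment[OF cz cz that] .
  have lim: "(\<lambda>n. slope_integral (z y c) (z (yn n) (cn n)) s) \<longlonglongrightarrow> slope_integral (z y c) (z y c) s"
    if "yn \<longlonglongrightarrow> y" "cn \<longlonglongrightarrow> c" "s \<in> {t..T}" for y c yn cn s
  proof (rule slope_integral_tendsto[OF cz cz _ that(3)])
    fix s assume s: "s \<in> {t..T}"
    let ?\<eta> = "\<lambda>n. \<bar>a\<bar> * \<bar>cn n - c\<bar> * (T - t)"
    have "\<bar>z (yn n) (cn n) s - z y c s\<bar> \<le> (2 + A * (T - t)) * exp (2 * A * (T - t))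
      * (\<bar>yn n - y\<bar> + ?\<eta> n)" for n
    proof (rule solution_stable[OF z z s d d])
      fix r assume r: "r \<in> {t..T}"
      have "d (cn n) r - d c r = a * (cn n - c) * (r - t)"
        by (simp add: d_def algebra_simps)
      hence "\<bar>d (cn n) r - d c r\<bar> = \<bar>a\<bar> * \<bar>cn n - c\<bar> * (r - t)"
        using r by (simp add: abs_mult)
      also have "\<dots> \<le> ?\<eta> n" using r by (intro mult_left_mono) auto
      finally show "\<bar>d (cn n) r - d c r\<bar> \<le> ?\<eta> n" .
    qed
    hence le: "\<forall>n. norm (z (yn n) (cn n) s - z y c s) \<le> (2 + A * (T - t)) * exp (2 * A
      * (T - t)) * (\<bar>yn n - y\<bar> + ?\<eta> n)"
      by simp
    have "(\<lambda>n. (2 + A * (T - t)) * exp (2 * A * (T - t)) * (\<bar>yn n - y\<bar> + ?\<eta> n))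
      \<longlonglongrightarrow> (2 + A * (T - t)) * exp (2 * A * (T - t)) * (\<bar>y - y\<bar> + \<bar>a\<bar> * \<bar>c - c\<bar> * (T - t))"
      by (intro tendsto_intros that)
    hence "(\<lambda>n. z (yn n) (cn n) s - z y c s) \<longlonglongrightarrow> 0"
      by (intro Lim_null_comparison[OF always_eventually[OF le]]) simp
    thus "(\<lambda>n. z (yn n) (cn n) s) \<longlonglongrightarrow> z y c s" by (simp add: LIM_zero_iff)
  qed
  show ?thesis
  proof (rule that)
    fix y c y' c' :: real
    have "(z y' c' T - z y c T) * e y c y' c' = y' - y + a * (c' - c) * j y c y' c'"
      unfolding e_def j_def by (rule solution_increment[OF z z]) (simp add: d_def algebra_simps)
    thus "(tilted_terminal w a y' c' - tilted_terminal w a y c) * e y c y' c' = y' - y + a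
      * (c' - c) * j y c y' c'"
      by (simp add: V)
    show "e y c y' c' > 0" by (simp add: e_def)
    have "(T - t) / (1 + (T - t) * A) \<le> integral {t..T} (\<lambda>s. exp (- (A * (s - t))))"
      by (rule integral_exp_decay_ge[OF t_less_T A_nonneg])
    also have "\<dots> \<le> j y c y' c'" unfolding j_def
    proof (intro integral_le integrable_continuous_interval cP)
      fix s assume "s \<in> {t..T}"
      thus "exp (- (A * (s - t))) \<le> exp (- slope_integral (z y c) (z y' c') s)"
        using P[of t s y c y' c'] by auto
    qed (intro continuous_intros)
    finally show "(T - t) / (1 + (T - t) * A) \<le> j y c y' c'" .
    have "(T - t) / (1 + (T - t) * A) * e y c y' c'
       \<le> integral {t..T} (\<lambda>s. exp (- (A * (T - s)))) * e y c y' c'"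
      by (intro mult_right_mono integral_exp_decay_ge[OF t_less_T A_nonneg]) (simp add: e_def)
    also have "\<dots> = integral {t..T} (\<lambda>s. exp (- (A * (T - s))) * e y c y' c')"
      by simp
    also have "\<dots> \<le> j y c y' c'" unfolding j_def
    proof (intro integral_le integrable_continuous_interval cP)
      fix s assume "s \<in> {t..T}"
      thus "exp (- (A * (T - s))) * e y c y' c' \<le> exp (- slope_integral (z y c) (z y' c') s)"
        using P[of s T y c y' c'] by (auto simp: e_def simp flip: exp_add)
    qed (intro continuous_intros)
    finally show "(T - t) / (1 + (T - t) * A) * e y c y' c' \<le> j y c y' c'" .
  next
    fix y c :: real and yn cn :: "nat \<Rightarrow> real"
    assume yc: "yn \<longlonglongrightarrow> y" "cn \<longlonglongrightarrow> c"
    show "(\<lambda>n. e y c (yn n) (cn n)) \<longlonglongrightarrow> e y c y c"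
      unfolding e_def by (intro tendsto_intros lim yc) (use t_less_T in auto)
    show "(\<lambda>n. j y c (yn n) (cn n)) \<longlonglongrightarrow> j y c y c"
      unfolding j_def
    proof (rule dominated_convergence(2))
      show "(\<lambda>_. exp (A * (T - t))) integrable_on {t..T}" by (rule integrable_const_ivl)
      fix s assume s: "s \<in> {t..T}"
      show "(\<lambda>n. exp (- slope_integral (z y c) (z (yn n) (cn n)) s)) \<longlonglongrightarrow> exp (- slope_integral
        (z y c) (z y c) s)"
        by (intro tendsto_intros lim yc s)
      fix n
      have "A * (s - t) \<le> A * (T - t)" using s A_nonneg by (intro mult_left_mono) auto
      thus "norm (exp (- slope_integral (z y c) (z (yn n) (cn n)) s)) \<le> exp (A * (T - t))"
        using P[of t s y c "yn n" "cn n"] s by auto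
    qed (intro integrable_continuous_interval cP)
  qed
qed

end

text \<open>
  An implicit function theorem for functions with exact increments.  The growth in \<open>c\<close> is at least
  linear, which gives solvability of \<open>V y c = x\<close>; solving the increment formula for \<open>c' - c\<close> gives
  the Lipschitz bound, and the derivative by passing to the limit in \<open>e\<close> and \<open>j\<close>.
\<close>

lemma implicit_level:
  fixes V :: "real \<Rightarrow> real \<Rightarrow> real" and e j :: "real \<Rightarrow> real \<Rightarrow> real \<Rightarrow> real \<Rightarrow> real"
  assumes a: "a > 0" and L: "L > 0"
    and inc: "\<And>y c y' c'. (V y' c' - V y c) * e y c y' c' = y' - y + a * (c' - c) * j y c y' c'"
    and e: "\<And>y c y' c'. e y c y' c' > 0"
    and j: "\<And>y c y' c'. L \<le> j y c y' c'"
    and ej: "\<And>y c y' c'. L * e y c y' c' \<le> j y c y' c'"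
    and e_lim: "\<And>y c yn cn. yn \<longlonglongrightarrow> y \<Longrightarrow> cn \<longlonglongrightarrow> c \<Longrightarrow> (\<lambda>n. e y c (yn n) (cn n)) \<longlonglongrightarrow> e y c y c"
    and j_lim: "\<And>y c yn cn. yn \<longlonglongrightarrow> y \<Longrightarrow> cn \<longlonglongrightarrow> c \<Longrightarrow> (\<lambda>n. j y c (yn n) (cn n)) \<longlonglongrightarrow> j y c y c"
  obtains C where "\<And>x y c. x < V y c \<longleftrightarrow> C x y < c"
    "\<And>x y x' y'. \<bar>C x' y' - C x y\<bar> \<le> 1 / (a * L) * (\<bar>x' - x\<bar> + \<bar>y' - y\<bar>)"
    "\<And>x y d1 d2. (\<lambda>h. C (x + h * d1) (y + h * d2)) differentiable (at 0)"
proof -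
  have j0: "j y c y' c' > 0" for y c y' c' using L j[of y c y' c'] by linarith
  have growth: "a * L * (c' - c) \<le> V y c' - V y c" if "c \<le> c'" for y c c'
  proof -
    have "a * (c' - c) * (L * e y c y c') \<le> a * (c' - c) * j y c y c'"
      using a that by (intro mult_left_mono ej) auto
    also have "\<dots> = (V y c' - V y c) * e y c y c'" using inc[where y=y and y'=y] by simp
    finally have "(a * L * (c' - c)) * e y c y c' \<le> (V y c' - V y c) * e y c y c'"
      by (simp add: algebra_simps)
    thus ?thesis using e by (simp add: mult_le_cancel_right_pos)
  qed
  have mono: "V y c < V y c'" if "c < c'" for y c c'
    using growth[of c c' y] that mult_pos_pos[OF mult_pos_pos[OF a L], of "c' - c"] by linarith
  have cont: "continuous_on S (V y)" for S y
  proof (rule continuous_at_imp_continuous_on, intro ballI)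
    fix c
    show "isCont (V y) c" unfolding continuous_at_sequentially
    proof (intro allI impI)
      fix cn assume cn: "cn \<longlonglongrightarrow> c"
      have "V y (cn n) = V y c + a * (cn n - c) * j y c y (cn n) / e y c y (cn n)" for n
        using inc[where y=y and y'=y and c=c and c'="cn n"] e[of y c y "cn n"] by
          (simp add: field_simps)
      moreover have "(\<lambda>n. V y c + a * (cn n - c) * j y c y (cn n) / e y c y (cn n))
        \<longlonglongrightarrow> V y c + a * (c - c) * j y c y c / e y c y c"
        by (intro tendsto_intros e_lim j_lim cn) (use e[of y c y c] in auto)
      ultimately show "(V y \<circ> cn) \<longlonglongrightarrow> V y c" by (simp add: o_def)
    qed
  qed
  have "\<exists>c. V y c = x" for x y
  proof -
    define m where "m = \<bar>x - V y 0\<bar> / (a * L)"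
    have m: "m \<ge> 0" "a * L * m = \<bar>x - V y 0\<bar>" using a L by (auto simp: m_def)
    have "V y (- m) \<le> x" "x \<le> V y m" using growth[of "- m" 0 y] growth[of 0 m y] m by auto
    with IVT'[of "V y" "- m" x m] m cont show ?thesis by auto
  qed
  define C where "C x y = (SOME c. V y c = x)" for x y
  have C: "V y (C x y) = x" for x y
    unfolding C_def by (rule someI_ex) fact
  have increment: "C x' y' - C x y
    = ((x' - x) * e y (C x y) y' (C x' y') - (y' - y)) / (a * j y (C x y) y' (C x' y'))" for x y x' y'
  proof -
    have "a * j y (C x y) y' (C x' y') \<noteq> 0" using a j0[of y "C x y" y' "C x' y'"] by simp
    moreover have "(C x' y' - C x y) * (a * j y (C x y) y' (C x' y'))
      = (x' - x) * e y (C x y) y' (C x' y') - (y' - y)"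
      using inc[where y=y and y'=y' and c="C x y" and c'="C x' y'"] by (simp add: C mult_ac)
    ultimately show ?thesis by (simp add: eq_divide_eq)
  qed
  have lip: "\<bar>C x' y' - C x y\<bar> \<le> (\<bar>x' - x\<bar> + \<bar>y' - y\<bar>) / (a * L)" for x y x' y'
  proof -
    let ?e = "e y (C x y) y' (C x' y')" and ?j = "j y (C x y) y' (C x' y')"
    have "\<bar>C x' y' - C x y\<bar> = \<bar>(x' - x) * ?e - (y' - y)\<bar> / (a * ?j)"
      using increment a j0 by (simp add: abs_mult abs_of_pos)
    also have "\<dots> \<le> (\<bar>x' - x\<bar> * ?e + \<bar>y' - y\<bar>) / (a * ?j)"
    proof (rule divide_right_mono)
      have "\<bar>(x' - x) * ?e\<bar> = \<bar>x' - x\<bar> * ?e" using e by (simp add: abs_mult abs_of_pos)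
      thus "\<bar>(x' - x) * ?e - (y' - y)\<bar> \<le> \<bar>x' - x\<bar> * ?e + \<bar>y' - y\<bar>" by linarith
    qed (simp add: a j0 less_imp_le)
    also have "\<dots> = (\<bar>x' - x\<bar> * (L * ?e) + \<bar>y' - y\<bar> * L) / ?j / (a * L)"
      using L a j0[of y "C x y" y' "C x' y'"] by (simp add: divide_simps) (simp add: algebra_simps)
    also have "\<dots> \<le> (\<bar>x' - x\<bar> * ?j + \<bar>y' - y\<bar> * ?j) / ?j / (a * L)"
      using a L j0[of y "C x y" y' "C x' y'"] by
        (intro divide_right_mono add_mono mult_left_mono ej j) auto
    also have "\<dots> = (\<bar>x' - x\<bar> + \<bar>y' - y\<bar>) / (a * L)"
      using j0[of y "C x y" y' "C x' y'"] by (simp flip: distrib_right)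
    finally show ?thesis .
  qed
  show ?thesis
  proof (rule that)
    show "\<bar>C x' y' - C x y\<bar> \<le> 1 / (a * L) * (\<bar>x' - x\<bar> + \<bar>y' - y\<bar>)" for x y x' y'
      using lip[of x' y' x y] by simp
  next
    fix x y c
    show "x < V y c \<longleftrightarrow> C x y < c"
      using mono[of "C x y" c y] mono[of c "C x y" y] C[of y x]
      by (cases c "C x y" rule: linorder_cases) auto
  next
    fix x y d1 d2 :: real
    let ?C = "\<lambda>h. C (x + h * d1) (y + h * d2)" and ?c = "C x y"
    have "(?C has_real_derivative (d1 * e y ?c y ?c - d2) / (a * j y ?c y ?c)) (at 0)"
      unfolding DERIV_def tendsto_at_iff_sequentially
    proof (intro allI impI)
      fix hn :: "nat \<Rightarrow> real"
      assume hn: "\<forall>n. hn n \<in> UNIV - {0}" "hn \<longlonglongrightarrow> 0"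
      have yn: "(\<lambda>n. y + hn n * d2) \<longlonglongrightarrow> y"
        using tendsto_add[OF tendsto_const tendsto_mult[OF hn(2) tendsto_const], of y d2] by simp
      have "(\<lambda>n. ?C (hn n) - C x y) \<longlonglongrightarrow> 0"
      proof (rule Lim_null_comparison[OF always_eventually])
        show "\<forall>n. norm (?C (hn n) - C x y) \<le> (\<bar>hn n * d1\<bar> + \<bar>hn n * d2\<bar>) / (a * L)"
          using lip[of "x + hn _ * d1" "y + hn _ * d2" x y] by simp
        have "(\<lambda>n. (\<bar>hn n * d1\<bar> + \<bar>hn n * d2\<bar>) / (a * L)) \<longlonglongrightarrow> (\<bar>0 * d1\<bar> + \<bar>0 * d2\<bar>) / (a * L)"
          by (intro tendsto_intros hn) (use a L in auto)
        thus "(\<lambda>n. (\<bar>hn n * d1\<bar> + \<bar>hn n * d2\<bar>) / (a * L)) \<longlonglongrightarrow> 0" by simp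
      qed
      hence cn: "(\<lambda>n. ?C (hn n)) \<longlonglongrightarrow> ?c" by (simp add: LIM_zero_iff)
      have "(?C (0 + hn n) - ?C 0) / hn n
        = (d1 * e y ?c (y + hn n * d2) (?C (hn n)) - d2) / (a * j y ?c (y + hn n * d2) (?C
          (hn n)))" for n
      proof -
        have "(hn n * d1 * E - hn n * d2) / J / hn n = (d1 * E - d2) / J" for E J
          using hn(1)[rule_format, of n] by (simp add: divide_simps) (simp add: algebra_simps)
        thus ?thesis using increment[of "x + hn n * d1" "y + hn n * d2" x y] by simp
      qed
      moreover have "(\<lambda>n. (d1 * e y ?c (y + hn n * d2) (?C (hn n)) - d2) / (a * j y ?c (y + hn n
        * d2) (?C (hn n))))
        \<longlonglongrightarrow> (d1 * e y ?c y ?c - d2) / (a * j y ?c y ?c)"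
        by (intro tendsto_intros e_lim j_lim yn cn) (use a j0[of y ?c y ?c] in auto)
      ultimately show "((\<lambda>h. (?C (0 + h) - ?C 0) / h) \<circ> hn) \<longlonglongrightarrow> (d1 * e y ?c y ?c - d2) / (a
        * j y ?c y ?c)"
        by (simp add: o_def)
    qed
    thus "?C differentiable (at 0)" by (auto simp: real_differentiable_def)
  qed
qed

section \<open>Gaussian shifts and weights\<close>

lemma normal_density_tilt:
  fixes c \<tau> v :: real
  assumes "\<tau> > 0"
  shows "normal_density 0 (sqrt \<tau>) v * exp (- c * v - c\<^sup>2 * \<tau> / 2) = normal_density (- c * \<tau>)
    (sqrt \<tau>) v"
proof -
  have "- (v\<^sup>2) / (2 * \<tau>) + (- c * v - c\<^sup>2 * \<tau> / 2) = - ((v + c * \<tau>)\<^sup>2) / (2 * \<tau>)"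
    using assms by (simp add: field_simps power2_eq_square)
  thus ?thesis using assms by (simp add: normal_density_def real_sqrt_pow2 flip: exp_add)
qed

text \<open>
  The one-dimensional Cameron-Martin formula: completing the square turns the tilted Gaussian density
  into the translated one.
\<close>

lemma gaussian_shift:
  fixes c \<delta> :: real
  assumes \<delta>: "\<delta> > 0" and B: "B \<in> sets borel"
  shows "(\<integral>\<^sup>+a. ennreal (exp (- c * a - c\<^sup>2 * \<delta> / 2)) * indicator B (a + c * \<delta>)
           \<partial>density lborel (normal_density 0 (sqrt \<delta>)))
    = emeasure (density lborel (normal_density 0 (sqrt \<delta>))) B"
proof -
  let ?\<phi> = "normal_density 0 (sqrt \<delta>)"
  have key: "?\<phi> a * exp (- c * a - c\<^sup>2 * \<delta> / 2) = ?\<phi> (a + c * \<delta>)" for a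
    using normal_density_tilt[OF \<delta>, of a c] by (simp add: normal_density_def)
  have "(\<integral>\<^sup>+a. ennreal (exp (- c * a - c\<^sup>2 * \<delta> / 2)) * indicator B (a + c * \<delta>) \<partial>density lborel ?\<phi>)
    = (\<integral>\<^sup>+a. ennreal (?\<phi> a) * (ennreal (exp (- c * a - c\<^sup>2 * \<delta> / 2)) * indicator B (a + c
      * \<delta>)) \<partial>lborel)"
    using B by (subst nn_integral_density) auto
  also have "\<dots> = (\<integral>\<^sup>+a. ennreal (?\<phi> (c * \<delta> + 1 * a)) * indicator B (c * \<delta> + 1 * a) \<partial>lborel)"
  proof (rule nn_integral_cong)
    fix a
    have "ennreal (?\<phi> (c * \<delta> + 1 * a)) = ennreal (?\<phi> a) * ennreal (exp (- c * a - c\<^sup>2 * \<delta> / 2))"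
      using key[of a] by (simp add: add.commute flip: ennreal_mult')
    thus "ennreal (?\<phi> a) * (ennreal (exp (- c * a - c\<^sup>2 * \<delta> / 2)) * indicator B (a + c * \<delta>))
      = ennreal (?\<phi> (c * \<delta> + 1 * a)) * indicator B (c * \<delta> + 1 * a)"
      by (simp add: mult.assoc add.commute)
  qed
  also have "\<dots> = (\<integral>\<^sup>+a. ennreal (?\<phi> a) * indicator B a \<partial>lborel)"
    using B nn_integral_real_affine[of "\<lambda>a. ennreal (?\<phi> a) * indicator B a" 1 "c * \<delta>"] by simp
  also have "\<dots> = emeasure (density lborel ?\<phi>) B"
    using B by (subst emeasure_density) auto
  finally show ?thesis .
qed

text \<open>
  Both the density and the indicator of a box factorise over the coordinates, so the one-dimensional
  shift settles boxes, and boxes determine the product measure.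
\<close>

lemma gaussian_product_shift:
  fixes c \<delta> :: real and I :: "'i set"
  assumes \<delta>: "\<delta> > 0" and I: "finite I"
  defines "N \<equiv> PiM I (\<lambda>_. density lborel (normal_density 0 (sqrt \<delta>)))"
  shows "distr (density N (\<lambda>a. ennreal (\<Prod>i\<in>I. exp (- c * a i - c\<^sup>2 * \<delta> / 2)))) N (\<lambda>a. \<lambda>i\<in>I. a i
    + c * \<delta>) = N"
proof -
  let ?N1 = "density lborel (normal_density 0 (sqrt \<delta>))"
  interpret N1: prob_space ?N1 using \<delta> by (intro prob_space_normal_density) simp
  interpret P: product_prob_space "\<lambda>_. ?N1" I by unfold_locales
  have shift: "(\<lambda>a. \<lambda>i\<in>I. a i + c * \<delta>) \<in> measurable N N"
    unfolding N_def by (intro measurable_restrict) measurable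
  show ?thesis unfolding N_def
  proof (rule P.PiM_eqI[OF I])
    fix A assume A: "\<And>i. i \<in> I \<Longrightarrow> A i \<in> sets ?N1"
    have PA: "Pi\<^sub>E I A \<in> sets N" unfolding N_def using I A by (intro sets_PiM_I_finite) auto
    have dm: "(\<lambda>a. ennreal (\<Prod>i\<in>I. exp (- c * a i - c\<^sup>2 * \<delta> / 2))) \<in> borel_measurable N"
      unfolding N_def using I by measurable
    have "emeasure (distr (density N (\<lambda>a. ennreal (\<Prod>i\<in>I. exp (- c * a i - c\<^sup>2 * \<delta> / 2)))) N
      (\<lambda>a. \<lambda>i\<in>I. a i + c * \<delta>)) (Pi\<^sub>E I A)
      = (\<integral>\<^sup>+a. ennreal (\<Prod>i\<in>I. exp (- c * a i - c\<^sup>2 * \<delta> / 2)) *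
           indicator ((\<lambda>a. \<lambda>i\<in>I. a i + c * \<delta>) -` Pi\<^sub>E I A \<inter> space N) a \<partial>N)"
      using PA shift dm by (simp add: emeasure_distr emeasure_density measurable_sets)
    also have "\<dots> = (\<integral>\<^sup>+a. (\<Prod>i\<in>I. ennreal (exp (- c * a i - c\<^sup>2 * \<delta> / 2)) * indicator (A i) (a i
      + c * \<delta>)) \<partial>N)"
    proof (rule nn_integral_cong)
      fix a assume a: "a \<in> space N"
      have "indicator ((\<lambda>a. \<lambda>i\<in>I. a i + c * \<delta>) -` Pi\<^sub>E I A \<inter> space N) a
         = (\<Prod>i\<in>I. indicator (A i) (a i + c * \<delta>) :: ennreal)"
        using a I by (auto simp: indicator_def prod_zero_iff PiE_iff)
      thus "ennreal (\<Prod>i\<in>I. exp (- c * a i - c\<^sup>2 * \<delta> / 2)) *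
           indicator ((\<lambda>a. \<lambda>i\<in>I. a i + c * \<delta>) -` Pi\<^sub>E I A \<inter> space N) a
         = (\<Prod>i\<in>I. ennreal (exp (- c * a i - c\<^sup>2 * \<delta> / 2)) * indicator (A i) (a i + c * \<delta>))"
        by (simp add: prod.distrib prod_ennreal)
    qed
    also have "\<dots> = (\<Prod>i\<in>I. \<integral>\<^sup>+a. ennreal (exp (- c * a - c\<^sup>2 * \<delta> / 2)) * indicator (A i) (a + c
      * \<delta>) \<partial>?N1)"
      unfolding N_def
    proof (rule P.product_nn_integral_prod[OF I])
      fix i assume "i \<in> I"
      from A[OF this] have [measurable]: "A i \<in> sets borel" by simp
      show "(\<lambda>a. ennreal (exp (- c * a - c\<^sup>2 * \<delta> / 2)) * indicator (A i) (a + c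
        * \<delta>)) \<in> borel_measurable ?N1"
        by measurable
    qed
    also have "\<dots> = (\<Prod>i\<in>I. emeasure ?N1 (A i))"
      using A by (intro prod.cong gaussian_shift \<delta> refl) simp
    finally show "emeasure (distr (density (PiM I (\<lambda>_. ?N1)) (\<lambda>a. ennreal (\<Prod>i\<in>I. exp (- c
      * a i - c\<^sup>2 * \<delta> / 2))))
      (PiM I (\<lambda>_. ?N1)) (\<lambda>a. \<lambda>i\<in>I. a i + c * \<delta>)) (Pi\<^sub>E I A) = (\<Prod>i\<in>I. emeasure ?N1 (A i))"
      unfolding N_def .
  qed simp
qed

text \<open>
  Independence turns an expectation into an integral against the product measure.
\<close>

lemma (in prob_space) independent_gaussian_shift:
  fixes X :: "'i \<Rightarrow> 'a \<Rightarrow> real" and c \<delta> :: real and f :: "('i \<Rightarrow> real) \<Rightarrow> real"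
  assumes \<delta>: "\<delta> > 0" and I: "finite I" "I \<noteq> {}"
    and indep: "indep_vars (\<lambda>_. borel) X I"
    and X: "\<And>i. i \<in> I \<Longrightarrow> distributed M lborel (X i) (normal_density 0 (sqrt \<delta>))"
    and f: "f \<in> borel_measurable (PiM I (\<lambda>_. borel))"
  shows "(\<integral>\<omega>. f (\<lambda>i\<in>I. X i \<omega>) \<partial>M)
    = (\<integral>\<omega>. (\<Prod>i\<in>I. exp (- c * X i \<omega> - c\<^sup>2 * \<delta> / 2)) * f (\<lambda>i\<in>I. X i \<omega> + c * \<delta>) \<partial>M)"
proof -
  let ?N1 = "density lborel (normal_density 0 (sqrt \<delta>))"
  define N where "N = PiM I (\<lambda>_. ?N1)"
  have sN: "sets N = sets (PiM I (\<lambda>_. borel))" unfolding N_def by (intro sets_PiM_cong) auto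
  have X_meas: "X i \<in> borel_measurable M" if "i \<in> I" for i
    using distributed_measurable[OF X[OF that]] by simp
  have "distr M borel (X i) = ?N1" if "i \<in> I" for i
  proof -
    have "distr M borel (X i) = distr M lborel (X i)" by (rule distr_cong) auto
    thus ?thesis using distributed_distr_eq_density[OF X[OF that]] by simp
  qed
  hence "PiM I (\<lambda>i. distr M borel (X i)) = N" unfolding N_def by (intro PiM_cong) auto
  hence D: "distr M (PiM I (\<lambda>_. borel)) (\<lambda>\<omega>. \<lambda>i\<in>I. X i \<omega>) = N"
    using indep X_meas indep_vars_iff_distr_eq_PiM'[OF I(2), where M'="\<lambda>_. borel" and X=X] by simp
  have XX: "(\<lambda>\<omega>. \<lambda>i\<in>I. X i \<omega>) \<in> measurable M (PiM I (\<lambda>_. borel))"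
    by (intro measurable_restrict X_meas)
  have fN: "f \<in> borel_measurable N" using f sN by (simp cong: measurable_cong_sets)
  have shift: "(\<lambda>a. \<lambda>i\<in>I. a i + c * \<delta>) \<in> measurable N N"
    unfolding N_def by (intro measurable_restrict) measurable
  have dm: "(\<lambda>a. \<Prod>i\<in>I. exp (- c * a i - c\<^sup>2 * \<delta> / 2)) \<in> borel_measurable N"
    unfolding N_def using I by measurable
  let ?g = "\<lambda>a. (\<Prod>i\<in>I. exp (- c * a i - c\<^sup>2 * \<delta> / 2)) * f (\<lambda>i\<in>I. a i + c * \<delta>)"
  have fs: "(\<lambda>a. f (\<lambda>i\<in>I. a i + c * \<delta>)) \<in> borel_measurable N"
    by (rule measurable_compose[OF shift fN])
  have "(\<integral>\<omega>. f (\<lambda>i\<in>I. X i \<omega>) \<partial>M) = (\<integral>a. f a \<partial>N)"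
    unfolding D[symmetric] by (rule integral_distr[OF XX f, symmetric])
  also have "\<dots> = (\<integral>a. f a \<partial>distr (density N (\<lambda>a. ennreal (\<Prod>i\<in>I. exp (- c * a i - c\<^sup>2
    * \<delta> / 2)))) N (\<lambda>a. \<lambda>i\<in>I. a i + c * \<delta>))"
    unfolding N_def by (subst gaussian_product_shift[OF \<delta> I(1)]) simp
  also have "\<dots> = (\<integral>a. f (\<lambda>i\<in>I. a i + c * \<delta>) \<partial>density N (\<lambda>a. ennreal (\<Prod>i\<in>I. exp (- c * a i - c\<^sup>2
    * \<delta> / 2))))"
    by (rule integral_distr) (use shift fN in auto)
  also have "\<dots> = (\<integral>a. ?g a \<partial>N)"
    using fs dm by (subst integral_density) (auto intro!: prod_nonneg)
  also have "\<dots> = (\<integral>\<omega>. ?g (\<lambda>i\<in>I. X i \<omega>) \<partial>M)"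
    unfolding D[symmetric] using fs dm sN
    by (intro integral_distr[OF XX]) (simp cong: measurable_cong_sets)
  also have "\<dots> = (\<integral>\<omega>. (\<Prod>i\<in>I. exp (- c * X i \<omega> - c\<^sup>2 * \<delta> / 2)) * f (\<lambda>i\<in>I. X i \<omega> + c * \<delta>) \<partial>M)"
    by (intro Bochner_Integration.integral_cong arg_cong2[where f="(*)"] arg_cong[where f=f] prod.cong refl) auto
  finally show ?thesis .
qed

text \<open>
  For a Gaussian v of variance \<open>\<tau>\<close>, exp (v^2 / (2 \<tau>)) just fails to be integrable, while the slightly
  smaller exponent below gives a multiple of a wider Gaussian density.
\<close>

lemma normal_density_quadratic_tilt:
  fixes \<tau> v :: real
  assumes "\<tau> > 0"
  shows "normal_density 0 (sqrt \<tau>) v * exp (v\<^sup>2 / (2 * (\<tau> + 1)))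
    = sqrt (\<tau> + 1) * normal_density 0 (sqrt (\<tau> * (\<tau> + 1))) v"
proof -
  have "- (v\<^sup>2) / (2 * \<tau>) + v\<^sup>2 / (2 * (\<tau> + 1)) = - (v\<^sup>2) / (2 * (\<tau> * (\<tau> + 1)))"
    using assms by (simp add: divide_simps) (simp add: algebra_simps)
  thus ?thesis using assms
    by (simp add: normal_density_def real_sqrt_mult power_mult_distrib mult.assoc flip: exp_add)
qed

text \<open>
  The Cameron-Martin density as a function of the tilt \<open>c\<close>, averaged against a standard Gaussian in
  \<open>c\<close>.  The extra Gaussian factor is what makes the supremum over \<open>c\<close> integrable in \<open>v\<close>.
\<close>

definition mixture_weight :: "real \<Rightarrow> real \<Rightarrow> real \<Rightarrow> real"
  where "mixture_weight \<tau> v c = exp (- c * v - c\<^sup>2 * \<tau> / 2) * std_normal_density c"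

lemma mixture_weight_eq:
  fixes c \<tau> v :: real
  assumes "\<tau> > 0"
  shows "mixture_weight \<tau> v c = exp (v\<^sup>2 / (2 * (\<tau> + 1))) / sqrt (\<tau> + 1)
     * normal_density (- v / (\<tau> + 1)) (1 / sqrt (\<tau> + 1)) c"
proof -
  have "- c * v - c\<^sup>2 * \<tau> / 2 + - (c\<^sup>2) / 2 = v\<^sup>2 / (2 * (\<tau> + 1)) + - ((c - - v / (\<tau>
    + 1))\<^sup>2) / (2 * (1 / sqrt (\<tau> + 1))\<^sup>2)"
    using assms by (simp add: power_divide divide_simps) (simp add: algebra_simps power2_eq_square)
  thus ?thesis using assms
    by (simp add: mixture_weight_def std_normal_density_def normal_density_def power_divide
        real_sqrt_divide real_sqrt_mult flip: exp_add)
qed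

lemma mixture_weight_integrable: "\<tau> > 0 \<Longrightarrow> integrable lborel (mixture_weight \<tau> v)"
  by (subst mixture_weight_eq[THEN ext]) simp_all

lemma mixture_weight_continuous: "continuous_on UNIV (mixture_weight \<tau> v)"
  unfolding mixture_weight_def[abs_def] std_normal_density_def by (intro continuous_intros) auto

lemma mixture_weight_pos: "mixture_weight \<tau> v c > 0"
  by (simp add: mixture_weight_def normal_density_pos)

lemma mixture_weight_le:
  assumes "\<tau> > 0"
  shows "mixture_weight \<tau> v c \<le> exp (v\<^sup>2 / (2 * (\<tau> + 1)))"
proof -
  have "mixture_weight \<tau> v c = exp (- c * v - c\<^sup>2 * \<tau> / 2 - c\<^sup>2 / 2) / sqrt (2 * pi)"
    by (simp add: mixture_weight_def std_normal_density_def flip: exp_add)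
  also have "\<dots> \<le> exp (- c * v - c\<^sup>2 * \<tau> / 2 - c\<^sup>2 / 2) / 1"
    using pi_ge_two by (intro divide_left_mono) auto
  also have "- c * v - c\<^sup>2 * \<tau> / 2 - c\<^sup>2 / 2 = v\<^sup>2 / (2 * (\<tau> + 1)) - (\<tau> + 1) / 2 * (c + v / (\<tau> + 1))\<^sup>2"
    using assms by (simp add: divide_simps) (simp add: algebra_simps power2_eq_square)
  also have "exp \<dots> / 1 \<le> exp (v\<^sup>2 / (2 * (\<tau> + 1)))" using assms by simp
  finally show ?thesis .
qed

section \<open>Tail integrals and differentiation of expectations\<close>

lemma tail_integral_has_derivative:
  fixes p :: "real \<Rightarrow> real"
  assumes int: "integrable lborel p" and cont: "continuous_on UNIV p"
  shows "((\<lambda>C. \<integral>c. indicator {C<..} c * p c \<partial>lborel) has_real_derivative - p C) (at C)"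
proof -
  let ?g = "\<lambda>C. \<integral>c. indicator {C<..} c * p c \<partial>lborel"
  have i: "integrable lborel (\<lambda>c. indicator S c * p c)" if "S \<in> sets borel" for S
    using integrable_mult_indicator[OF _ int, of S] that by simp
  have g: "?g C' = ?g (C - 1) - integral {C - 1..C'} p" if "C' \<in> {C - 1..C + 1}" for C'
  proof -
    have "?g (C - 1) = (\<integral>c. indicator {C - 1<..C'} c * p c + indicator {C'<..} c * p c \<partial>lborel)"
      using that by (intro Bochner_Integration.integral_cong refl) (auto simp: indicator_def)
    also have "\<dots> = (\<integral>c. indicator {C - 1<..C'} c * p c \<partial>lborel) + ?g C'"
      by (intro Bochner_Integration.integral_add i) auto
    also have "(\<integral>c. indicator {C - 1<..C'} c * p c \<partial>lborel) = (\<integral>c. indicator {C - 1..C'} c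
      * p c \<partial>lborel)"
    proof (rule integral_cong_AE)
      show "AE c in lborel. indicator {C - 1<..C'} c * p c = indicator {C - 1..C'} c * p c"
        using AE_lborel_singleton[of "C - 1"] by eventually_elim (auto simp: indicator_def)
    qed (use borel_measurable_continuous_onI[OF cont] in auto)
    also have "\<dots> = integral {C - 1..C'} p"
      using set_borel_integral_eq_integral(2)[of "{C - 1..C'}" p] i[of "{C - 1..C'}"]
      by (simp add: set_lebesgue_integral_def set_integrable_def)
    finally show ?thesis by simp
  qed
  have "((\<lambda>C'. ?g (C - 1) - integral {C - 1..C'} p) has_real_derivative 0 - p C)
    (at C within {C - 1..C + 1})"
    by (intro DERIV_diff DERIV_const integral_has_real_derivative continuous_on_subset[OF cont]) auto
  hence "((\<lambda>C'. ?g (C - 1) - integral {C - 1..C'} p) has_real_derivative - p C)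
    (at C within {C - 1..C + 1})"
    by simp
  hence "(?g has_real_derivative - p C) (at C within {C - 1..C + 1})"
  proof (rule has_field_derivative_transform_within[where d=1])
    fix C' assume "C' \<in> {C - 1..C + 1}"
    thus "?g (C - 1) - integral {C - 1..C'} p = ?g C'" by (rule g[symmetric])
  qed auto
  thus ?thesis by (simp add: at_within_Icc_at)
qed

text \<open>
  The tail integral is nonnegative and strictly decreasing.
\<close>

lemma tail_integral_pos:
  fixes p :: "real \<Rightarrow> real"
  assumes "integrable lborel p" "continuous_on UNIV p" "\<And>c. p c > 0"
  shows "(\<integral>c. indicator {C<..} c * p c \<partial>lborel) > 0"
proof -
  have "(\<integral>c. indicator {C + 1<..} c * p c \<partial>lborel) < (\<integral>c. indicator {C<..} c * p c \<partial>lborel)"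
    by (rule DERIV_neg_imp_decreasing[of C "C + 1"])
       (use tail_integral_has_derivative[OF assms(1,2)] assms(3) in \<open>auto intro!: exI\<close>)
  moreover have "(\<integral>c. indicator {C + 1<..} c * p c \<partial>lborel) \<ge> 0"
    using assms(3) by (intro integral_nonneg_AE AE_I2 mult_nonneg_nonneg) (auto intro: less_imp_le)
  ultimately show ?thesis by linarith
qed

lemma tail_integral_lipschitz:
  fixes p :: "real \<Rightarrow> real"
  assumes "integrable lborel p" "continuous_on UNIV p" "\<And>c. \<bar>p c\<bar> \<le> B"
  shows "\<bar>(\<integral>c. indicator {C<..} c * p c \<partial>lborel) - (\<integral>c. indicator {C'<..} c * p c \<partial>lborel)\<bar> \<le> B
    * \<bar>C - C'\<bar>"
  using field_differentiable_bound[OF convex_UNIV, of "\<lambda>C. \<integral>c. indicator {C<..} c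
    * p c \<partial>lborel" "\<lambda>C. - p C" B C C']
    tail_integral_has_derivative[OF assms(1,2)] assms(3) by simp

text \<open>
  Dominated convergence along sequences.  The limit \<open>G\<close> of the difference quotients is taken along the
  steps 1 / (n + 1), which makes it measurable; differentiability identifies it with the limit along
  any other sequence.
\<close>

lemma differentiable_expectation:
  fixes R :: "real \<Rightarrow> 'a \<Rightarrow> real"
  assumes int: "\<And>h. integrable M (R h)"
    and diff: "AE \<omega> in M. (\<lambda>h. R h \<omega>) differentiable (at 0)"
    and L: "integrable M L" "AE \<omega> in M. \<forall>h. \<bar>R h \<omega> - R 0 \<omega>\<bar> \<le> L \<omega> * \<bar>h\<bar>"
  shows "(\<lambda>h. \<integral>\<omega>. R h \<omega> \<partial>M) differentiable (at 0)"
proof -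
  define q where "q h \<omega> = (R h \<omega> - R 0 \<omega>) / h" for h \<omega>
  define G where "G \<omega> = lim (\<lambda>n. q (1 / Suc n) \<omega>)" for \<omega>
  have q_meas: "q h \<in> borel_measurable M" for h
    unfolding q_def using int by (auto intro!: borel_measurable_diff borel_measurable_divide)
  have qL: "AE \<omega> in M. \<forall>h. h \<noteq> 0 \<longrightarrow> ((\<lambda>h. q h \<omega>) \<longlongrightarrow> G \<omega>) (at 0) \<and> \<bar>q h \<omega>\<bar> \<le> L \<omega>"
    using diff L(2)
  proof eventually_elim
    case (elim \<omega>)
    then obtain D where D: "((\<lambda>h. q h \<omega>) \<longlongrightarrow> D) (at 0)"
      by (auto simp: real_differentiable_def DERIV_def q_def)
    have "(\<lambda>n. q (1 / Suc n) \<omega>) \<longlonglongrightarrow> D"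
      using D[unfolded tendsto_at_iff_sequentially, rule_format, of "\<lambda>n. 1 / Suc n"] LIMSEQ_inverse_real_of_nat
      by (simp add: o_def inverse_eq_divide)
    hence "G \<omega> = D" unfolding G_def by (rule limI)
    thus ?case using D elim(2) by (auto simp: q_def abs_divide divide_le_eq)
  qed
  have "((\<lambda>h. \<integral>\<omega>. R h \<omega> \<partial>M) has_real_derivative (\<integral>\<omega>. G \<omega> \<partial>M)) (at 0)"
    unfolding DERIV_def tendsto_at_iff_sequentially
  proof (intro allI impI)
    fix hn :: "nat \<Rightarrow> real"
    assume hn: "\<forall>n. hn n \<in> UNIV - {0}" "hn \<longlonglongrightarrow> 0"
    have "(\<lambda>n. \<integral>\<omega>. q (hn n) \<omega> \<partial>M) \<longlonglongrightarrow> (\<integral>\<omega>. G \<omega> \<partial>M)"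
    proof (rule integral_dominated_convergence[OF _ q_meas L(1)])
      show "G \<in> borel_measurable M" unfolding G_def using q_meas by measurable
      show "AE \<omega> in M. (\<lambda>n. q (hn n) \<omega>) \<longlonglongrightarrow> G \<omega>" using qL
      proof eventually_elim
        case (elim \<omega>)
        hence "((\<lambda>h. q h \<omega>) \<longlongrightarrow> G \<omega>) (at 0)" by (metis one_neq_zero)
        thus ?case using hn by (auto simp: tendsto_at_iff_sequentially o_def)
      qed
      show "AE \<omega> in M. norm (q (hn n) \<omega>) \<le> L \<omega>" for n
        using qL by eventually_elim (use hn in auto)
    qed
    moreover have "(\<integral>\<omega>. q (hn n) \<omega> \<partial>M) = ((\<integral>\<omega>. R (0 + hn n) \<omega> \<partial>M) - (\<integral>\<omega>. R 0 \<omega> \<partial>M)) / hn n" for n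
      unfolding q_def using int by simp
    ultimately show "((\<lambda>h. ((\<integral>\<omega>. R (0 + h) \<omega> \<partial>M) - (\<integral>\<omega>. R 0 \<omega> \<partial>M)) / h) \<circ> hn) \<longlonglongrightarrow> (\<integral>\<omega>. G \<omega> \<partial>M)"
      by (simp add: o_def)
  qed
  thus ?thesis by (auto simp: real_differentiable_def)
qed

text \<open>
  A one-sided bound on the increments suffices, since it is used on both sides of the point.
\<close>

lemma abs_derivative_le:
  fixes f :: "real \<Rightarrow> real"
  assumes D: "(f has_real_derivative D) (at 0)"
    and le: "eventually (\<lambda>h. f h - f 0 \<le> B * \<bar>h\<bar>) (at 0)"
  shows "\<bar>D\<bar> \<le> B"
proof -
  have lim: "((\<lambda>h. (f h - f 0) / h) \<longlongrightarrow> D) (at 0)" using D by (simp add: DERIV_def)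
  have "D \<le> B"
  proof (rule tendsto_upperbound)
    show "((\<lambda>h. (f h - f 0) / h) \<longlongrightarrow> D) (at_right 0)" using lim by (rule tendsto_within_subset) auto
    have "eventually (\<lambda>h. f h - f 0 \<le> B * \<bar>h\<bar>) (at_right 0)"
      using le by (auto simp: eventually_at_split)
    moreover have "eventually (\<lambda>h::real. h > 0) (at_right 0)" by (rule eventually_at_right_less)
    ultimately show "eventually (\<lambda>h. (f h - f 0) / h \<le> B) (at_right 0)"
      by eventually_elim (auto simp: field_simps)
  qed simp
  moreover have "- B \<le> D"
  proof (rule tendsto_lowerbound)
    show "((\<lambda>h. (f h - f 0) / h) \<longlongrightarrow> D) (at_left 0)" using lim by (rule tendsto_within_subset) auto
    have "eventually (\<lambda>h. f h - f 0 \<le> B * \<bar>h\<bar>) (at_left 0)"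
      using le by (auto simp: eventually_at_split)
    moreover have "eventually (\<lambda>h::real. h < 0) (at_left 0)" by (simp add: eventually_at_filter)
    ultimately show "eventually (\<lambda>h. - B \<le> (f h - f 0) / h) (at_left 0)"
      by eventually_elim (auto simp: field_simps)
  qed simp
  ultimately show ?thesis by auto
qed

section \<open>The shift of Brownian motion along a line\<close>

locale additive_noise_sde = lipschitz_drift b t T A + prob_space M
  for b t T A and M :: "'a measure" +
  fixes W :: "real \<Rightarrow> 'a \<Rightarrow> real" and \<epsilon> :: real
  assumes eps: "\<epsilon> > 0" and bm: "brownian_motion_on M {t..T} W"
begin

definition driver :: "real \<Rightarrow> 'a \<Rightarrow> real \<Rightarrow> real"
  where "driver c \<omega> s = sqrt \<epsilon> * (W s \<omega> - W t \<omega> + c * (s - t))"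

definition increment :: "'a \<Rightarrow> real"
  where "increment \<omega> = W T \<omega> - W t \<omega>"

text \<open>
  The density that compensates the tilt by \<open>c\<close>.
\<close>

definition girsanov :: "real \<Rightarrow> 'a \<Rightarrow> real"
  where "girsanov c \<omega> = exp (- c * increment \<omega> - c\<^sup>2 * (T - t) / 2)"

lemma W_measurable: "s \<in> {t..T} \<Longrightarrow> W s \<in> borel_measurable M"
  using bm by (auto simp: brownian_motion_on_def)

lemma increment_measurable [measurable]: "increment \<in> borel_measurable M"
  unfolding increment_def[abs_def] using t_less_T by (intro borel_measurable_diff W_measurable) auto

lemma girsanov_measurable [measurable]: "girsanov c \<in> borel_measurable M"
  unfolding girsanov_def[abs_def] by measurable

lemma girsanov_pos: "girsanov c \<omega> > 0"
  by (simp add: girsanov_def)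

lemma driver_measurable: "s \<in> {t..T} \<Longrightarrow> (\<lambda>\<omega>. driver c \<omega> s) \<in> borel_measurable M"
  unfolding driver_def using t_less_T by
    (auto intro!: borel_measurable_times borel_measurable_add borel_measurable_diff W_measurable)

lemma driver_continuous: "AE \<omega> in M. \<forall>c. continuous_on {t..T} (driver c \<omega>)"
proof -
  have "AE \<omega> in M. continuous_on {t..T} (\<lambda>s. W s \<omega>)"
    using bm by (auto simp: brownian_motion_on_def)
  thus ?thesis
    by eventually_elim (auto simp: driver_def[abs_def] intro!: continuous_intros)
qed

lemma W_difference_distributed:
  "\<lbrakk>r \<in> {t..T}; s \<in> {t..T}; r < s\<rbrakk> \<Longrightarrow>
    distributed M lborel (\<lambda>\<omega>. W s \<omega> - W r \<omega>) (normal_density 0 (sqrt (s - r)))"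
  using bm unfolding brownian_motion_on_def by blast

lemma increment_distributed:
  "distributed M lborel increment (normal_density 0 (sqrt (T - t)))"
  unfolding increment_def[abs_def] using t_less_T by (intro W_difference_distributed) auto

text \<open>
  Tilting the Gaussian density of the increment gives the density of a translated Gaussian.
\<close>

lemma girsanov_integrable: "integrable M (girsanov c)"
  and girsanov_expectation: "(\<integral>\<omega>. girsanov c \<omega> \<partial>M) = 1"
proof -
  have tau: "T - t > 0" using t_less_T by simp
  let ?g = "\<lambda>v. exp (- c * v - c\<^sup>2 * (T - t) / 2)"
  note eq = normal_density_tilt[OF tau, of _ c]
  show "integrable M (girsanov c)"
    unfolding girsanov_def[abs_def]
    using distributed_integrable[OF increment_distributed, of ?g, unfolded eq] tau by simp
  show "(\<integral>\<omega>. girsanov c \<omega> \<partial>M) = 1"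
    unfolding girsanov_def
    using distributed_integral[OF increment_distributed, of ?g, unfolded eq] tau by simp
qed

text \<open>
  The random constant that dominates \<open>mixture_weight\<close> uniformly in \<open>c\<close>.
\<close>

lemma envelope_integrable: "integrable M (\<lambda>\<omega>. exp ((increment \<omega>)\<^sup>2 / (2 * (T - t + 1))))"
proof -
  have tau: "T - t > 0" using t_less_T by simp
  show ?thesis
    using distributed_integrable[OF increment_distributed, of "\<lambda>v. exp (v\<^sup>2 / (2 * (T - t + 1)))",
        unfolded normal_density_quadratic_tilt[OF tau]] tau
    by simp
qed

text \<open>
  On a uniform grid the tilt adds the same constant \<open>c \<delta>\<close> to each of the independent Gaussian
  increments, and the product of the one-dimensional densities collapses to \<open>girsanov c\<close> because the
  increments sum to \<open>W T - W t\<close>.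
\<close>

lemma cameron_martin_grid:
  assumes n: "n > 0" and g [measurable]: "g \<in> borel_measurable borel"
  shows "(\<integral>\<omega>. g (terminal y (bernstein_path n (\<lambda>k. driver 0 \<omega> (node n k)))) \<partial>M)
    = (\<integral>\<omega>. girsanov c \<omega> * g (terminal y (bernstein_path n (\<lambda>k. driver c \<omega> (node n k)))) \<partial>M)"
proof -
  define \<delta> where "\<delta> = (T - t) / n"
  define X where "X i \<omega> = W (node n (Suc i)) \<omega> - W (node n i) \<omega>" for i \<omega>
  define f where "f a = g (terminal y (bernstein_path n (\<lambda>k. sqrt \<epsilon> * (\<Sum>i<k. a i))))" for a
  have \<delta>: "\<delta> > 0" using n t_less_T by (simp add: \<delta>_def)
  have node0: "node n 0 = t" and noden: "node n n = T" using n by (auto simp: node_def)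
  have node: "node n k - t = k * \<delta>" for k by (simp add: node_def \<delta>_def)
  have step: "node n (Suc i) - node n i = \<delta>" for i
    using node[of "Suc i"] node[of i] by (simp add: algebra_simps)
  have sumX: "(\<Sum>i<k. X i \<omega>) = W (node n k) \<omega> - W t \<omega>" for k \<omega>
    using sum_lessThan_telescope[of "\<lambda>i. W (node n i) \<omega>" k] by (simp add: X_def node0)
  have driver: "driver c \<omega> (node n k) = sqrt \<epsilon> * (\<Sum>i<k. X i \<omega> + c * \<delta>)" for c \<omega> k
    using node[of k] by (simp add: driver_def sum.distrib sumX algebra_simps)
  have bp: "bernstein_path n (\<lambda>k. sqrt \<epsilon> * (\<Sum>i<k. (\<lambda>i\<in>{..<n}. X i \<omega> + c * \<delta>) i))
     = bernstein_path n (\<lambda>k. driver c \<omega> (node n k))" for c \<omega>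
    unfolding driver by (intro bernstein_path_cong arg_cong[where f="(*) (sqrt \<epsilon>)"] sum.cong refl) auto
  have f1: "f (\<lambda>i\<in>{..<n}. X i \<omega> + c * \<delta>) = g (terminal y (bernstein_path n (\<lambda>k. driver c \<omega>
    (node n k))))" for c \<omega>
    by (simp only: f_def bp)
  have f0: "f (\<lambda>i\<in>{..<n}. X i \<omega>) = g (terminal y (bernstein_path n (\<lambda>k. driver 0 \<omega> (node n k))))" for \<omega>
  proof -
    have "bernstein_path n (\<lambda>k. sqrt \<epsilon> * (\<Sum>i<k. (\<lambda>i\<in>{..<n}. X i \<omega>) i)) = bernstein_path n
      (\<lambda>k. driver 0 \<omega> (node n k))"
      unfolding driver by (intro bernstein_path_cong arg_cong[where f="(*) (sqrt \<epsilon>)"] sum.cong) auto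
    thus ?thesis by (simp only: f_def)
  qed
  have dens: "(\<Prod>i<n. exp (- c * X i \<omega> - c\<^sup>2 * \<delta> / 2)) = girsanov c \<omega>" for \<omega>
  proof -
    have "(\<Sum>i<n. - c * X i \<omega> - c\<^sup>2 * \<delta> / 2) = - c * (\<Sum>i<n. X i \<omega>) - n * (c\<^sup>2 * \<delta> / 2)"
      by (simp add: sum_subtractf sum_distrib_left sum_negf)
    also have "\<dots> = - c * increment \<omega> - c\<^sup>2 * (T - t) / 2"
      using n by (simp add: sumX noden increment_def \<delta>_def)
    finally show ?thesis by (simp add: girsanov_def flip: exp_sum)
  qed
  have "(\<integral>\<omega>. f (\<lambda>i\<in>{..<n}. X i \<omega>) \<partial>M)
    = (\<integral>\<omega>. (\<Prod>i<n. exp (- c * X i \<omega> - c\<^sup>2 * \<delta> / 2)) * f (\<lambda>i\<in>{..<n}. X i \<omega> + c * \<delta>) \<partial>M)"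
  proof (rule independent_gaussian_shift[OF \<delta>])
    show "{..<n} \<noteq> {}" using n by auto
    have "\<forall>i\<le>n. node n i \<in> {t..T}" "\<forall>i<n. node n i < node n (Suc i)"
      using node_in n step \<delta> by (auto simp: algebra_simps)
    thus "indep_vars (\<lambda>_. borel) X {..<n}"
      using bm unfolding brownian_motion_on_def X_def by blast
    show "distributed M lborel (X i) (normal_density 0 (sqrt \<delta>))" if "i \<in> {..<n}" for i
    proof -
      have "node n i < node n (Suc i)" using step[of i] \<delta> by linarith
      thus ?thesis using W_difference_distributed[of "node n i" "node n (Suc i)"] node_in[of i n]
          node_in[of "Suc i" n] that n step by (simp add: X_def[abs_def])
    qed
    show "f \<in> borel_measurable (PiM {..<n} (\<lambda>_. borel))"
      unfolding f_def
    proof (rule measurable_compose[OF terminal_bernstein_measurable g])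
      fix k assume k: "k \<le> n"
      have "(\<lambda>a. a i) \<in> borel_measurable (PiM {..<n} (\<lambda>_. borel :: real measure))" if "i \<in> {..<k}" for i
        using that k by (intro measurable_component_singleton) auto
      thus "(\<lambda>a. sqrt \<epsilon> * (\<Sum>i<k. a i)) \<in> borel_measurable (PiM {..<n} (\<lambda>_. borel))"
        by (intro borel_measurable_times borel_measurable_const borel_measurable_sum)
    qed
  qed simp
  thus ?thesis by (simp only: f0 f1 dens)
qed

lemma flow_driver_measurable [measurable]: "(\<lambda>\<omega>. flow y (driver c \<omega>)) \<in> borel_measurable M"
  by (intro flow_measurable driver_measurable)

text \<open>
  Dominated convergence as the grids are refined.
\<close>

lemma cameron_martin_flow:
  assumes g: "continuous_on UNIV g" and g1: "\<And>v. \<bar>g v\<bar> \<le> 1"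
  shows "(\<integral>\<omega>. g (flow y (driver 0 \<omega>)) \<partial>M) = (\<integral>\<omega>. girsanov c \<omega> * g (flow y (driver c \<omega>)) \<partial>M)"
proof -
  have [measurable]: "g \<in> borel_measurable borel" using g by (rule borel_measurable_continuous_onI)
  let ?\<Phi> = "\<lambda>c n \<omega>. terminal y (bernstein_path (Suc n) (\<lambda>k. driver c \<omega> (node (Suc n) k)))"
  have [measurable]: "?\<Phi> c n \<in> borel_measurable M" for c n
    by (intro terminal_bernstein_measurable driver_measurable node_in) auto
  have lim: "AE \<omega> in M. \<forall>c. (\<lambda>n. g (?\<Phi> c n \<omega>)) \<longlonglongrightarrow> g (flow y (driver c \<omega>))"
    using driver_continuous
  proof eventually_elim
    case (elim \<omega>)
    show ?case
    proof
      fix c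
      have "(\<lambda>n. ?\<Phi> c n \<omega>) \<longlonglongrightarrow> flow y (driver c \<omega>)"
        using elim by (simp add: flow_eq_terminal terminal_bernstein_tendsto)
      thus "(\<lambda>n. g (?\<Phi> c n \<omega>)) \<longlonglongrightarrow> g (flow y (driver c \<omega>))"
        by (intro continuous_on_tendsto_compose[OF g]) auto
    qed
  qed
  have "(\<lambda>n. \<integral>\<omega>. girsanov c \<omega> * g (?\<Phi> c n \<omega>) \<partial>M) \<longlonglongrightarrow> (\<integral>\<omega>. girsanov c \<omega> * g (flow y (driver c \<omega>)) \<partial>M)"
  proof (rule integral_dominated_convergence)
    show "integrable M (girsanov c)" by (rule girsanov_integrable)
    show "AE \<omega> in M. (\<lambda>n. girsanov c \<omega> * g (?\<Phi> c n \<omega>)) \<longlonglongrightarrow> girsanov c \<omega> * g (flow y (driver c \<omega>))"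
      using lim by eventually_elim (auto intro!: tendsto_intros)
    show "AE \<omega> in M. norm (girsanov c \<omega> * g (?\<Phi> c n \<omega>)) \<le> girsanov c \<omega>" for n
      using g1 by (intro AE_I2)
        (auto simp: abs_mult abs_of_pos girsanov_pos intro!: mult_left_le less_imp_le)
  qed measurable
  moreover have "(\<lambda>n. \<integral>\<omega>. g (?\<Phi> 0 n \<omega>) \<partial>M) \<longlonglongrightarrow> (\<integral>\<omega>. g (flow y (driver 0 \<omega>)) \<partial>M)"
  proof (rule integral_dominated_convergence)
    show "integrable M (\<lambda>_. 1::real)" by simp
    show "AE \<omega> in M. (\<lambda>n. g (?\<Phi> 0 n \<omega>)) \<longlonglongrightarrow> g (flow y (driver 0 \<omega>))"
      using lim by eventually_elim auto
    show "AE \<omega> in M. norm (g (?\<Phi> 0 n \<omega>)) \<le> 1" for n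
      using g1 by (intro AE_I2) auto
  qed measurable
  moreover have "(\<integral>\<omega>. g (?\<Phi> 0 n \<omega>) \<partial>M) = (\<integral>\<omega>. girsanov c \<omega> * g (?\<Phi> c n \<omega>) \<partial>M)" for n
    by (rule cameron_martin_grid) auto
  ultimately show ?thesis using LIMSEQ_unique by simp
qed

definition exceedance :: "real \<Rightarrow> real \<Rightarrow> real"
  where "exceedance x y = (\<integral>\<omega>. indicator {x<..} (flow y (driver 0 \<omega>)) \<partial>M)"

text \<open>
  Indicators of half-lines are limits of bounded continuous functions.
\<close>

lemma exceedance_girsanov:
  "exceedance x y = (\<integral>\<omega>. girsanov c \<omega> * indicator {x<..} (flow y (driver c \<omega>)) \<partial>M)"
proof -
  \<comment> \<open>Ramps that rise from 0 at \<open>x\<close> to 1 at \<open>x + 1 / k\<close>.\<close>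
  define g where "g k v = min 1 (max 0 (real k * (v - x)))" for k v
  have gc: "continuous_on UNIV (g k)" for k unfolding g_def by (intro continuous_intros)
  have [measurable]: "g k \<in> borel_measurable borel" for k using gc by
    (rule borel_measurable_continuous_onI)
  have g1: "\<bar>g k v\<bar> \<le> 1" for k v by (auto simp: g_def)
  have lim: "(\<lambda>k. g k v) \<longlonglongrightarrow> indicator {x<..} v" for v
  proof (cases "v > x")
    case True
    have "eventually (\<lambda>k. g k v = indicator {x<..} v) sequentially"
      using eventually_ge_at_top[of "nat \<lceil>1 / (v - x)\<rceil>"]
    proof eventually_elim
      case (elim k)
      hence "1 / (v - x) \<le> real k" by linarith
      hence "1 \<le> real k * (v - x)" using True by (simp add: field_simps)
      thus ?case using True by (simp add: g_def)
    qed
    thus ?thesis by (rule tendsto_eventually)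
  next
    case False
    hence "real k * (v - x) \<le> 0" for k by (intro mult_nonneg_nonpos) auto
    hence "g k v = indicator {x<..} v" for k using False by (simp add: g_def max_absorb1)
    thus ?thesis by simp
  qed
  have "(\<lambda>k. \<integral>\<omega>. girsanov c \<omega> * g k (flow y (driver c \<omega>)) \<partial>M)
    \<longlonglongrightarrow> (\<integral>\<omega>. girsanov c \<omega> * indicator {x<..} (flow y (driver c \<omega>)) \<partial>M)"
  proof (rule integral_dominated_convergence)
    show "integrable M (girsanov c)" by (rule girsanov_integrable)
    show "AE \<omega> in M. norm (girsanov c \<omega> * g k (flow y (driver c \<omega>))) \<le> girsanov c \<omega>" for k
      using g1 by (intro AE_I2)
        (auto simp: abs_mult abs_of_pos girsanov_pos intro!: mult_left_le less_imp_le)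
    show "AE \<omega> in M. (\<lambda>k. girsanov c \<omega> * g k (flow y (driver c \<omega>))) \<longlonglongrightarrow> girsanov c \<omega>
      * indicator {x<..} (flow y (driver c \<omega>))"
      by (intro AE_I2 tendsto_intros lim)
  qed measurable
  moreover have "(\<lambda>k. \<integral>\<omega>. g k (flow y (driver 0 \<omega>)) \<partial>M) \<longlonglongrightarrow> exceedance x y"
    unfolding exceedance_def
  proof (rule integral_dominated_convergence)
    show "integrable M (\<lambda>_. 1::real)" by simp
    show "AE \<omega> in M. norm (g k (flow y (driver 0 \<omega>))) \<le> 1" for k using g1 by (intro AE_I2) auto
    show "AE \<omega> in M. (\<lambda>k. g k (flow y (driver 0 \<omega>))) \<longlonglongrightarrow> indicator {x<..} (flow y (driver 0 \<omega>))"
      by (intro AE_I2 lim)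
  qed measurable
  ultimately show ?thesis using LIMSEQ_unique cameron_martin_flow[OF gc g1, of _ y c] by simp
qed

subsection \<open>Level sets in the tilt parameter\<close>

text \<open>
  (1 + \<tau> A) / (\<tau> sqrt \<epsilon>): the tilt that compensates a unit change of the level or of the starting
  point.
\<close>

definition slope_bound :: real
  where "slope_bound = 1 / (sqrt \<epsilon> * ((T - t) / (1 + (T - t) * A)))"

text \<open>
  On the path of \<open>\<omega>\<close>, \<open>C x y\<close> is the tilt at which the terminal value started from \<open>y\<close> equals \<open>x\<close>.
\<close>

definition level_map :: "'a \<Rightarrow> (real \<Rightarrow> real \<Rightarrow> real) \<Rightarrow> bool" where
  "level_map \<omega> C \<longleftrightarrow> (\<forall>x y c. x < flow y (driver c \<omega>) \<longleftrightarrow> C x y < c)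
    \<and> (\<forall>x y x' y'. \<bar>C x' y' - C x y\<bar> \<le> slope_bound * (\<bar>x' - x\<bar> + \<bar>y' - y\<bar>))
    \<and> (\<forall>x y d1 d2. (\<lambda>h. C (x + h * d1) (y + h * d2)) differentiable (at 0))"

lemma level_map_exists: "AE \<omega> in M. \<exists>C. level_map \<omega> C"
  using driver_continuous
proof eventually_elim
  case (elim \<omega>)
  have V: "tilted_terminal (driver 0 \<omega>) (sqrt \<epsilon>) y c = flow y (driver c \<omega>)" for y c
  proof -
    have "(\<lambda>s. driver 0 \<omega> s + sqrt \<epsilon> * c * (s - t)) = driver c \<omega>"
      by (simp add: driver_def fun_eq_iff algebra_simps)
    thus ?thesis using elim by (simp add: tilted_terminal_def flow_eq_terminal)
  qed
  have L: "(T - t) / (1 + (T - t) * A) > 0"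
    using t_less_T A_nonneg by (intro divide_pos_pos add_pos_nonneg) auto
  from elim have "continuous_on {t..T} (driver 0 \<omega>)" by blast
  from tilted_terminal_increment[OF this, of "sqrt \<epsilon>"] obtain e j where ej:
    "\<And>y c y' c'. (flow y' (driver c' \<omega>) - flow y (driver c \<omega>)) * e y c y' c' = y' - y + sqrt \<epsilon>
      * (c' - c) * j y c y' c'"
    "\<And>y c y' c'. e y c y' c' > 0"
    "\<And>y c y' c'. (T - t) / (1 + (T - t) * A) \<le> j y c y' c'"
    "\<And>y c y' c'. (T - t) / (1 + (T - t) * A) * e y c y' c' \<le> j y c y' c'"
    "\<And>y c yn cn. yn \<longlonglongrightarrow> y \<Longrightarrow> cn \<longlonglongrightarrow> c \<Longrightarrow> (\<lambda>n. e y c (yn n) (cn n)) \<longlonglongrightarrow> e y c y c"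
    "\<And>y c yn cn. yn \<longlonglongrightarrow> y \<Longrightarrow> cn \<longlonglongrightarrow> c \<Longrightarrow> (\<lambda>n. j y c (yn n) (cn n)) \<longlonglongrightarrow> j y c y c"
    unfolding V by blast
  obtain C where "\<And>x y c. x < flow y (driver c \<omega>) \<longleftrightarrow> C x y < c"
    "\<And>x y x' y'. \<bar>C x' y' - C x y\<bar> \<le> slope_bound * (\<bar>x' - x\<bar> + \<bar>y' - y\<bar>)"
    "\<And>x y d1 d2. (\<lambda>h. C (x + h * d1) (y + h * d2)) differentiable (at 0)"
    unfolding slope_bound_def
    by (rule implicit_level[where V="\<lambda>y c. flow y
      (driver c \<omega>)" and e=e and j=j and a="sqrt \<epsilon>", OF _ L ej])
       (use eps in auto)
  thus ?case unfolding level_map_def by blast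
qed

subsection \<open>Smoothness and positivity of the exceedance probability\<close>

lemma flow_driver_measurable_pair [measurable]:
  "(\<lambda>(c, \<omega>). flow y (driver c \<omega>)) \<in> borel_measurable (lborel \<Otimes>\<^sub>M M)"
proof -
  have "(\<lambda>v. flow y (driver (fst v) (snd v))) \<in> borel_measurable (lborel \<Otimes>\<^sub>M M)"
  proof (rule flow_measurable)
    fix s assume s: "s \<in> {t..T}"
    have [measurable]: "W s \<in> borel_measurable M" "W t \<in> borel_measurable M"
      using s t_less_T by (auto intro: W_measurable)
    show "(\<lambda>v. driver (fst v) (snd v) s) \<in> borel_measurable (lborel \<Otimes>\<^sub>M M)"
      unfolding driver_def by measurable
  qed
  thus ?thesis by (simp add: split_beta')
qed

text \<open>
  The Cameron-Martin formula holds for every tilt, so its average over tilts also represents the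
  probability; on a fixed path the average integrates a smooth weight over a half-line of tilts.
\<close>

definition mixture :: "real \<Rightarrow> real \<Rightarrow> 'a \<Rightarrow> real" where
  "mixture x y \<omega> = (\<integral>c. mixture_weight (T - t) (increment \<omega>) c * indicator {x<..} (flow y
    (driver c \<omega>)) \<partial>lborel)"

lemma mixture_integrable: "integrable M (mixture x y)"
  and mixture_expectation: "(\<integral>\<omega>. mixture x y \<omega> \<partial>M) = exceedance x y"
proof -
  interpret pair_sigma_finite lborel M by unfold_locales
  let ?F = "\<lambda>c \<omega>. mixture_weight (T - t) (increment \<omega>) c * indicator {x<..} (flow y
    (driver c \<omega>)) :: real"
  have F: "?F c \<omega> = std_normal_density c * (girsanov c \<omega> * indicator {x<..} (flow y
    (driver c \<omega>)))" for c \<omega>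
    by (simp add: mixture_weight_def girsanov_def)
  have E: "(\<integral>\<omega>. ?F c \<omega> \<partial>M) = std_normal_density c * exceedance x y" for c
    unfolding F by (simp add: exceedance_girsanov[of x y c])
  have int: "integrable (lborel \<Otimes>\<^sub>M M) (case_prod ?F)"
  proof (rule Fubini_integrable)
    show "case_prod ?F \<in> borel_measurable (lborel \<Otimes>\<^sub>M M)"
      unfolding mixture_weight_def std_normal_density_def split_beta' by measurable
    have "norm (case (c, \<omega>) of (c, \<omega>) \<Rightarrow> ?F c \<omega>) = ?F c \<omega>" for c \<omega>
      using mixture_weight_pos[of "T - t" "increment \<omega>" c] by (simp add: abs_mult)
    thus "integrable lborel (\<lambda>c. \<integral>\<omega>. norm (case (c, \<omega>) of (c, \<omega>) \<Rightarrow> ?F c \<omega>) \<partial>M)"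
      by (simp only: E) simp
    have "integrable M (\<lambda>\<omega>. girsanov c \<omega> * indicator {x<..} (flow y (driver c \<omega>)))" for c
      by (rule Bochner_Integration.integrable_bound[OF girsanov_integrable[of c]])
         (auto simp: indicator_def)
    thus "AE c in lborel. integrable M (\<lambda>\<omega>. case (c, \<omega>) of (c, \<omega>) \<Rightarrow> ?F c \<omega>)"
      unfolding split_conv F by (intro AE_I2 integrable_mult_right) auto
  qed
  show "integrable M (mixture x y)" unfolding mixture_def[abs_def] by (rule integrable_snd[OF int])
  have "(\<integral>\<omega>. mixture x y \<omega> \<partial>M) = (\<integral>c. (\<integral>\<omega>. ?F c \<omega> \<partial>M) \<partial>lborel)"
    unfolding mixture_def by (rule Fubini_integral[OF int])
  thus "(\<integral>\<omega>. mixture x y \<omega> \<partial>M) = exceedance x y" by (simp add: E)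
qed

lemma mixture_eq_tail:
  assumes "level_map \<omega> C"
  shows "mixture x y \<omega> = (\<integral>c. indicator {C x y<..} c * mixture_weight (T - t) (increment \<omega>) c \<partial>lborel)"
  unfolding mixture_def
  by (intro Bochner_Integration.integral_cong refl)
     (use assms in \<open>auto simp: level_map_def indicator_def\<close>)

lemma slope_bound_pos: "slope_bound > 0"
  unfolding slope_bound_def
  using t_less_T A_nonneg eps by
    (intro divide_pos_pos mult_pos_pos add_pos_nonneg mult_nonneg_nonneg) auto

text \<open>
  On almost every path the mixture is a tail integral starting at the level \<open>C\<close>, so the chain rule
  applies, and the difference quotients are dominated by the supremum of the weight times the
  Lipschitz constant of \<open>C\<close>.
\<close>

lemma exceedance_differentiable:
  "(\<lambda>h. exceedance (x + h * d1) (y + h * d2)) differentiable (at 0)"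
proof -
  have tau: "T - t > 0" using t_less_T by simp
  let ?p = "\<lambda>\<omega>. mixture_weight (T - t) (increment \<omega>)"
  let ?B = "\<lambda>\<omega>. exp ((increment \<omega>)\<^sup>2 / (2 * (T - t + 1)))"
  define R where "R h = mixture (x + h * d1) (y + h * d2)" for h
  have p: "integrable lborel (?p \<omega>)" "continuous_on UNIV (?p \<omega>)" "\<bar>?p \<omega> c\<bar> \<le> ?B \<omega>" for \<omega> c
    using mixture_weight_integrable[OF tau] mixture_weight_continuous mixture_weight_le[OF tau]
      mixture_weight_pos[of "T - t" "increment \<omega>" c] by (auto simp: abs_of_pos)
  have "(\<lambda>h. \<integral>\<omega>. R h \<omega> \<partial>M) differentiable (at 0)"
  proof (rule differentiable_expectation)
    show "integrable M (R h)" for h unfolding R_def by (rule mixture_integrable)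
    show "AE \<omega> in M. (\<lambda>h. R h \<omega>) differentiable (at 0)"
      using level_map_exists
    proof eventually_elim
      case (elim \<omega>)
      then obtain C where C: "level_map \<omega> C" by blast
      then obtain D where "((\<lambda>h. C (x + h * d1) (y + h * d2)) has_real_derivative D) (at 0)"
        unfolding level_map_def real_differentiable_def by blast
      from DERIV_chain2[OF tail_integral_has_derivative[OF p(1,2)] this, of \<omega>]
      show ?case unfolding R_def mixture_eq_tail[OF C] by (auto simp: real_differentiable_def)
    qed
    show "integrable M (\<lambda>\<omega>. ?B \<omega> * (slope_bound * (\<bar>d1\<bar> + \<bar>d2\<bar>)))"
      by (intro integrable_mult_left envelope_integrable)
    show "AE \<omega> in M. \<forall>h. \<bar>R h \<omega> - R 0 \<omega>\<bar> \<le> ?B \<omega> * (slope_bound * (\<bar>d1\<bar> + \<bar>d2\<bar>)) * \<bar>h\<bar>"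
      using level_map_exists
    proof eventually_elim
      case (elim \<omega>)
      then obtain C where C: "level_map \<omega> C" by blast
      show ?case
      proof
        fix h
        have "\<bar>R h \<omega> - R 0 \<omega>\<bar> \<le> ?B \<omega> * \<bar>C (x + h * d1) (y + h * d2) - C (x + 0 * d1) (y + 0 * d2)\<bar>"
          unfolding R_def mixture_eq_tail[OF C] by (rule tail_integral_lipschitz[OF p])
        also have "\<dots> \<le> ?B \<omega> * (slope_bound * (\<bar>x + h * d1 - (x + 0 * d1)\<bar> + \<bar>y + h * d2 - (y + 0
          * d2)\<bar>))"
          using C unfolding level_map_def by (intro mult_left_mono) (blast, simp)
        also have "\<dots> = ?B \<omega> * (slope_bound * (\<bar>d1\<bar> + \<bar>d2\<bar>)) * \<bar>h\<bar>"
          by (simp add: abs_mult algebra_simps)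
        finally show "\<bar>R h \<omega> - R 0 \<omega>\<bar> \<le> ?B \<omega> * (slope_bound * (\<bar>d1\<bar> + \<bar>d2\<bar>)) * \<bar>h\<bar>" .
      qed
    qed
  qed
  thus ?thesis by (simp add: R_def mixture_expectation)
qed

lemma exceedance_pos: "exceedance x y > 0"
proof -
  have tau: "T - t > 0" using t_less_T by simp
  have pos: "AE \<omega> in M. mixture x y \<omega> > 0"
    using level_map_exists
  proof eventually_elim
    case (elim \<omega>)
    then obtain C where C: "level_map \<omega> C" by blast
    show ?case unfolding mixture_eq_tail[OF C]
      by (intro tail_integral_pos mixture_weight_integrable[OF tau] mixture_weight_continuous mixture_weight_pos)
  qed
  hence nonneg: "AE \<omega> in M. 0 \<le> mixture x y \<omega>" by eventually_elim simp
  have "exceedance x y \<noteq> 0"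
  proof
    assume "exceedance x y = 0"
    hence "AE \<omega> in M. mixture x y \<omega> = 0"
      using integral_nonneg_eq_0_iff_AE[OF mixture_integrable nonneg] by (simp add: mixture_expectation)
    with pos have "AE \<omega> in M. False" by eventually_elim simp
    thus False by simp
  qed
  moreover have "exceedance x y \<ge> 0"
    using integral_nonneg_AE[OF nonneg] by (simp add: mixture_expectation)
  ultimately show ?thesis by simp
qed

subsection \<open>The logarithmic gradient bound\<close>

lemma indicator_flow_integrable: "integrable M (\<lambda>\<omega>. indicator {x<..} (flow y (driver c \<omega>)) :: real)"
  by (rule Bochner_Integration.integrable_bound[of M "\<lambda>_. 1::real"]) (auto simp: indicator_def)

lemma exceedance_le_1: "exceedance x y \<le> 1"
proof -
  have "exceedance x y \<le> (\<integral>\<omega>. 1 \<partial>M)"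
    unfolding exceedance_def by (intro integral_mono indicator_flow_integrable) auto
  thus ?thesis by (simp add: prob_space)
qed

text \<open>
  Tilting by \<open>- k\<close> costs the density exp (k \<xi> - k^2 \<tau> / 2) and, since \<open>C\<close> varies by at most \<open>k\<close> between
  the two points, sends the event for (x', y') into the event for (x, y).  The expectation of the
  density on that event is estimated by Hoelder's inequality, in the pointwise form of Young's
  inequality with the optimal scaling \<open>exp m\<close>.
\<close>

lemma ln_exceedance_increment:
  fixes x y x' y' p :: real
  assumes p: "p > 1"
  defines "k \<equiv> slope_bound * (\<bar>x' - x\<bar> + \<bar>y' - y\<bar>)"
  shows "ln (exceedance x' y') \<le> ln (exceedance x y) + (p - 1) * k\<^sup>2 * (T - t) / 2 - ln
    (exceedance x y) / p"
proof -
  let ?u = "exceedance x y"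
  define m where "m = (p - 1) * k\<^sup>2 * (T - t) / 2 - ln ?u / p"
  let ?I = "\<lambda>\<omega>. indicator {x<..} (flow y (driver 0 \<omega>)) :: real"
  \<comment> \<open>Convexity of the exponential function between 0 and \<open>p s\<close>.\<close>
  have young: "girsanov (- k) \<omega> \<le> exp m * (1 - 1 / p) + exp m / p * (?u * girsanov (- p * k) \<omega>)" for \<omega>
  proof -
    define s where "s = k * increment \<omega> - k\<^sup>2 * (T - t) / 2 - m"
    have "exp ((1 - 1 / p) * 0 + 1 / p * (p * s)) \<le> (1 - 1 / p) * exp 0 + 1 / p * exp (p * s)"
      using convex_onD[OF exp_convex, of "1 / p" 0 "p * s"] p by simp
    hence "exp m * exp s \<le> exp m * ((1 - 1 / p) + 1 / p * exp (p * s))"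
      using p by simp
    moreover have "exp m * exp s = girsanov (- k) \<omega>"
      by (simp add: girsanov_def s_def flip: exp_add)
    moreover have "exp (p * s) = ?u * girsanov (- p * k) \<omega>"
    proof -
      have "p * m = p * (p - 1) * k\<^sup>2 * (T - t) / 2 - ln ?u"
        using p by (simp add: m_def field_simps)
      hence "p * s = ln ?u + (- (- p * k) * increment \<omega> - (- p * k)\<^sup>2 * (T - t) / 2)"
        by (simp add: s_def power2_eq_square algebra_simps) (simp add: field_simps)
      thus ?thesis using exceedance_pos[of x y] by (simp add: girsanov_def exp_add)
    qed
    ultimately show ?thesis by (simp add: algebra_simps)
  qed
  have "exceedance x' y' = (\<integral>\<omega>. girsanov (- k) \<omega> * indicator {x'<..} (flow y' (driver (- k) \<omega>)) \<partial>M)"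
    by (rule exceedance_girsanov)
  also have "\<dots> \<le> (\<integral>\<omega>. exp m * (1 - 1 / p) * ?I \<omega> + exp m / p * (?u * girsanov (- p * k) \<omega>) \<partial>M)"
  proof (rule integral_mono_AE)
    show "integrable M (\<lambda>\<omega>. girsanov (- k) \<omega> * indicator {x'<..} (flow y' (driver (- k) \<omega>)))"
      by (rule Bochner_Integration.integrable_bound[OF girsanov_integrable[of "- k"]])
        (auto simp: indicator_def)
    show "integrable M (\<lambda>\<omega>. exp m * (1 - 1 / p) * ?I \<omega> + exp m / p * (?u * girsanov (- p * k) \<omega>))"
      by (intro Bochner_Integration.integrable_add integrable_mult_right indicator_flow_integrable girsanov_integrable) 
    show "AE \<omega> in M. girsanov (- k) \<omega> * indicator {x'<..} (flow y' (driver (- k) \<omega>))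
      \<le> exp m * (1 - 1 / p) * ?I \<omega> + exp m / p * (?u * girsanov (- p * k) \<omega>)"
      using level_map_exists
    proof eventually_elim
      case (elim \<omega>)
      then obtain C where C: "level_map \<omega> C" by blast
      show ?case
      proof (cases "x' < flow y' (driver (- k) \<omega>)")
        case True
        have "\<bar>C x' y' - C x y\<bar> \<le> k" using C by (simp add: level_map_def k_def)
        moreover have "C x' y' < - k" using C True by (simp add: level_map_def)
        ultimately have "C x y < 0" by linarith
        hence "x < flow y (driver 0 \<omega>)" using C by (simp add: level_map_def)
        thus ?thesis using young[of \<omega>] True by simp
      next
        case False
        have "0 \<le> exp m * (1 - 1 / p) * ?I \<omega>" using p by (intro mult_nonneg_nonneg) auto
        moreover have "0 \<le> exp m / p * (?u * girsanov (- p * k) \<omega>)"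
          using p exceedance_pos[of x y] girsanov_pos[of "- p * k" \<omega>] by (intro mult_nonneg_nonneg) auto
        ultimately show ?thesis using False by simp
      qed
    qed
  qed
  also have "\<dots> = exp m * (1 - 1 / p) * ?u + exp m / p * (?u * 1)"
    by (subst Bochner_Integration.integral_add)
       (simp_all only: integrable_mult_right indicator_flow_integrable girsanov_integrable
        integral_mult_right_zero girsanov_expectation exceedance_def)
  also have "\<dots> = exp m * ?u" by (simp add: algebra_simps)
  finally have "ln (exceedance x' y') \<le> ln (exp m * ?u)"
    using exceedance_pos by (subst ln_le_cancel_iff) auto
  also have "\<dots> = m + ln ?u" using exceedance_pos[of x y] by (simp add: ln_mult)
  finally show ?thesis by (simp add: m_def)
qed

text \<open>
  Minimising over the exponent p in \<open>ln_exceedance_increment\<close> leads to p = sqrt (2 L / \<tau>) / k with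
  L = - ln u.  This exponent exceeds 1 only for nearby points, which is the first alternative of the
  hypothesis; if u = 1 the left-hand side is nonpositive and there is nothing to optimise.
\<close>

lemma ln_exceedance_lipschitz:
  assumes small: "(slope_bound * (\<bar>x' - x\<bar> + \<bar>y' - y\<bar>))\<^sup>2 * (T - t) < - 2 * ln
    (exceedance x y) \<or> exceedance x y = 1"
  shows "ln (exceedance x' y') - ln (exceedance x y)
    \<le> slope_bound * sqrt (- 2 * (T - t) * ln (exceedance x y)) * (\<bar>x' - x\<bar> + \<bar>y' - y\<bar>)"
proof (cases "exceedance x y = 1")
  case True
  have "ln (exceedance x' y') \<le> 0" using exceedance_le_1 exceedance_pos by (simp add: ln_le_zero_iff)
  thus ?thesis using True by simp
next
  case False
  define d where "d = \<bar>x' - x\<bar> + \<bar>y' - y\<bar>"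
  define k where "k = slope_bound * d"
  define L where "L = - ln (exceedance x y)"
  define \<tau> where "\<tau> = T - t"
  have \<tau>: "\<tau> > 0" using t_less_T by (simp add: \<tau>_def)
  have k2: "k\<^sup>2 * \<tau> < 2 * L" using small False by (simp add: k_def d_def L_def \<tau>_def)
  have "0 \<le> k\<^sup>2 * \<tau>" using \<tau> by simp
  with k2 have L: "L > 0" by linarith
  have "k \<ge> 0" using slope_bound_pos by (simp add: k_def d_def)
  show ?thesis
  proof (cases "k = 0")
    case True
    hence "x' = x \<and> y' = y" using slope_bound_pos by (simp add: k_def d_def add_nonneg_eq_0_iff)
    thus ?thesis by simp
  next
    case False
    with \<open>k \<ge> 0\<close> have k: "k > 0" by simp
    define r where "r = sqrt (2 * L / \<tau>)"
    have r: "r > 0" "r\<^sup>2 = 2 * L / \<tau>" using L \<tau> by (auto simp: r_def)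
    have "k < r" unfolding r_def using k2 \<tau> by (intro real_less_rsqrt) (simp add: field_simps)
    hence p: "r / k > 1" using k by simp
    have "ln (exceedance x' y') + L \<le> (r / k - 1) * k\<^sup>2 * \<tau> / 2 + L / (r / k)"
      using ln_exceedance_increment[OF p, where x=x and y=y and x'=x' and y'=y'] by
        (simp add: k_def d_def L_def \<tau>_def)
    also have "\<dots> \<le> r / k * k\<^sup>2 * \<tau> / 2 + L / (r / k)"
      using \<tau> by (simp add: algebra_simps)
    also have "\<dots> = k * (r * \<tau>)"
    proof -
      have "L = r\<^sup>2 * \<tau> / 2" using r \<tau> by simp
      thus ?thesis using k r by (simp add: field_simps power2_eq_square)
    qed
    also have "r * \<tau> = sqrt (2 * \<tau> * L)"
    proof -
      have "2 * \<tau> * L = (r * \<tau>)\<^sup>2"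
        unfolding power_mult_distrib r(2) using \<tau> by (simp add: power2_eq_square)
      moreover have "sqrt ((r * \<tau>)\<^sup>2) = r * \<tau>" using r \<tau> by simp
      ultimately show ?thesis by simp
    qed
    finally show ?thesis by (simp add: k_def d_def L_def \<tau>_def algebra_simps)
  qed
qed

text \<open>
  A direction (d1, d2) of l1 length 1 treats the derivatives in \<open>x\<close> and in \<open>y\<close> simultaneously.
\<close>

lemma rate_derivative_bound:
  fixes x y d1 d2 :: real
  assumes d: "\<bar>d1\<bar> + \<bar>d2\<bar> = 1"
  defines "q \<equiv> \<lambda>h. - \<epsilon> * ln (exceedance (x + h * d1) (y + h * d2))"
  shows "q differentiable (at 0)"
    and "\<bar>deriv q 0\<bar> \<le> (1 + (T - t) * A) * sqrt (2 * q 0 / (T - t))"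
proof -
  define f where "f h = ln (exceedance (x + h * d1) (y + h * d2))" for h
  obtain D0 where "((\<lambda>h. exceedance (x + h * d1) (y + h * d2)) has_real_derivative D0) (at 0)"
    using exceedance_differentiable unfolding real_differentiable_def by blast
  from DERIV_chain2[OF DERIV_ln[OF exceedance_pos] this]
  obtain D where D: "(f has_real_derivative D) (at 0)" unfolding f_def by blast
  have q: "(q has_real_derivative - \<epsilon> * D) (at 0)"
    unfolding q_def using DERIV_cmult[OF D, of "- \<epsilon>"] by (simp add: f_def)
  thus "q differentiable (at 0)" by (auto simp: real_differentiable_def)
  let ?\<tau> = "T - t"
  have \<tau>: "?\<tau> > 0" using t_less_T by simp
  let ?B = "slope_bound * sqrt (- 2 * ?\<tau> * f 0)"
  have "\<bar>D\<bar> \<le> ?B"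
  proof (rule abs_derivative_le[OF D])
    have "eventually (\<lambda>h. (slope_bound * \<bar>h\<bar>)\<^sup>2 * ?\<tau> < - 2 * f 0 \<or> exceedance x y = 1) (at 0)"
    proof (cases "exceedance x y = 1")
      case False
      hence "f 0 < 0" using exceedance_pos[of x y] exceedance_le_1[of x y] by (simp add: f_def)
      moreover have "((\<lambda>h. (slope_bound * \<bar>h\<bar>)\<^sup>2 * ?\<tau>) \<longlongrightarrow> (slope_bound * \<bar>0\<bar>)\<^sup>2 * ?\<tau>) (at 0)"
        by (intro tendsto_intros)
      ultimately have "eventually (\<lambda>h. (slope_bound * \<bar>h\<bar>)\<^sup>2 * ?\<tau> < - 2 * f 0) (at 0)"
        by (intro order_tendstoD(2)) auto
      thus ?thesis by eventually_elim simp
    qed simp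
    thus "eventually (\<lambda>h. f h - f 0 \<le> ?B * \<bar>h\<bar>) (at 0)"
    proof eventually_elim
      case (elim h)
      have "\<bar>h\<bar> * \<bar>d1\<bar> + \<bar>h\<bar> * \<bar>d2\<bar> = \<bar>h\<bar>" using d by (simp flip: distrib_left)
      hence "\<bar>x + h * d1 - x\<bar> + \<bar>y + h * d2 - y\<bar> = \<bar>h\<bar>" by (simp add: abs_mult)
      with ln_exceedance_lipschitz[of "x + h * d1" x "y + h * d2" y] elim
      show ?case by (simp add: f_def)
    qed
  qed
  have "\<bar>deriv q 0\<bar> = \<epsilon> * \<bar>D\<bar>" using DERIV_imp_deriv[OF q] eps by (simp add: abs_mult)
  also have "\<dots> \<le> \<epsilon> * ?B" using \<open>\<bar>D\<bar> \<le> ?B\<close> eps by (intro mult_left_mono) auto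
  also have "\<dots> = (1 + ?\<tau> * A) * sqrt (2 * q 0 / ?\<tau>)"
  proof -
    have "sqrt (2 * q 0 / ?\<tau>) = sqrt \<epsilon> * (sqrt (- 2 * ?\<tau> * f 0) / ?\<tau>)"
    proof -
      have "2 * (- \<epsilon> * v) / u = \<epsilon> * (- 2 * u * v / u\<^sup>2)" if "u > 0" for u v :: real
        using that by (simp add: power2_eq_square)
      from this[OF \<tau>, of "f 0"] have "2 * q 0 / ?\<tau> = \<epsilon> * (- 2 * ?\<tau> * f 0 / ?\<tau>\<^sup>2)"
        by (simp only: q_def f_def)
      thus ?thesis using \<tau> by (simp only: real_sqrt_mult real_sqrt_divide real_sqrt_abs)
    qed
    moreover have "\<epsilon> * slope_bound = (1 + ?\<tau> * A) / ?\<tau> * sqrt \<epsilon>"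
    proof -
      have "\<epsilon> = sqrt \<epsilon> * sqrt \<epsilon>" using eps by simp
      hence "\<epsilon> * slope_bound = sqrt \<epsilon> * (sqrt \<epsilon> * slope_bound)" by (metis mult.assoc)
      also have "sqrt \<epsilon> * slope_bound = (1 + ?\<tau> * A) / ?\<tau>" using eps by (simp add: slope_bound_def)
      finally show ?thesis by (simp add: mult.commute)
    qed
    ultimately show ?thesis by (simp add: mult.assoc[symmetric])
  qed
  finally show "\<bar>deriv q 0\<bar> \<le> (1 + (T - t) * A) * sqrt (2 * q 0 / (T - t))" .
qed

text \<open>
  The null set on which the equation may fail depends on the starting point; this is harmless, since
  only one starting point enters the probability.
\<close>

lemma u_eps_eq_exceedance:
  assumes Y: "sde_solution M W b \<epsilon> t T y (Y y)"
  shows "u_eps M Y T x y = exceedance x y"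
proof -
  have T: "T \<in> {t..T}" using t_less_T by simp
  have [measurable]: "Y y T \<in> borel_measurable M" using Y T by (auto simp: sde_solution_def)
  have "AE \<omega> in M. continuous_on {t..T} (\<lambda>s. Y y s \<omega>) \<and>
        (\<forall>s\<in>{t..T}. Y y s \<omega> =
           y + integral {t..s} (\<lambda>r. b (Y y r \<omega>) r) + sqrt \<epsilon> * (W s \<omega> - W t \<omega>))"
    using Y by (auto simp: sde_solution_def)
  hence eq: "AE \<omega> in M. Y y T \<omega> = flow y (driver 0 \<omega>)"
    using driver_continuous
  proof eventually_elim
    case (elim \<omega>)
    hence "solves y (driver 0 \<omega>) (\<lambda>s. Y y s \<omega>)" by (auto simp: solves_def driver_def)
    with elim(2) show ?case by (simp add: flow_eq_terminal terminal_eq)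
  qed
  have "u_eps M Y T x y = (\<integral>\<omega>. indicator {\<omega> \<in> space M. x < Y y T \<omega>} \<omega> \<partial>M)"
    unfolding u_eps_def by simp
  also have "\<dots> = exceedance x y"
    unfolding exceedance_def
  proof (rule integral_cong_AE)
    show "AE \<omega> in M. indicator {\<omega> \<in> space M. x < Y y T \<omega>} \<omega> = (indicator {x<..} (flow y
      (driver 0 \<omega>)) :: real)"
      using eq AE_space by eventually_elim (auto simp: indicator_def)
  qed measurable
  finally show ?thesis .
qed

end

section \<open>The gradient estimate for the rate function\<close>

theorem corollary6p1:
  fixes b :: "real \<Rightarrow> real \<Rightarrow> real"
    and T A \<epsilon> t x y :: real
    and M :: "'a measure"
    and W :: "real \<Rightarrow> 'a \<Rightarrow> real"
    and Y :: "real \<Rightarrow> real \<Rightarrow> 'a \<Rightarrow> real"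
  assumes "T > 0" and "A \<ge> 0" and "\<epsilon> > 0"
    and b_cont: "continuous_on (UNIV \<times> {..T}) (\<lambda>(z, s). b z s)"
    and b_diff: "\<And>z s. s \<le> T \<Longrightarrow> (\<lambda>\<zeta>. b \<zeta> s) differentiable (at z)"
    and b_deriv_cont: "continuous_on (UNIV \<times> {..T}) (\<lambda>(z, s). deriv (\<lambda>\<zeta>. b \<zeta> s) z)"
    and b_deriv_bound: "\<And>z s. s \<le> T \<Longrightarrow> \<bar>deriv (\<lambda>\<zeta>. b \<zeta> s) z\<bar> \<le> A"
    and "t < T"
    and W: "brownian_motion_on M {t..T} W"
    and Y: "\<And>z. sde_solution M W b \<epsilon> t T z (Y z)"
  shows "(\<lambda>\<xi>. q_eps M Y T \<epsilon> \<xi> y) differentiable (at x)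
       \<and> (\<lambda>\<eta>. q_eps M Y T \<epsilon> x \<eta>) differentiable (at y)
       \<and> \<bar>deriv (\<lambda>\<xi>. q_eps M Y T \<epsilon> \<xi> y) x\<bar>
            \<le> (1 + (T - t) * A) * sqrt (2 * q_eps M Y T \<epsilon> x y / (T - t))
       \<and> \<bar>deriv (\<lambda>\<eta>. q_eps M Y T \<epsilon> x \<eta>) y\<bar>
            \<le> (1 + (T - t) * A) * sqrt (2 * q_eps M Y T \<epsilon> x y / (T - t))"
proof -
  interpret prob_space M using W by (simp add: brownian_motion_on_def)
  interpret additive_noise_sde b t T A M W \<epsilon>
  proof unfold_locales
    show "continuous_on (UNIV \<times> {t..T}) (\<lambda>(z, s). b z s)"
      by (rule continuous_on_subset[OF b_cont]) auto
    show "continuous_on (UNIV \<times> {t..T}) (\<lambda>(z, s). deriv (\<lambda>\<zeta>. b \<zeta> s) z)"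
      by (rule continuous_on_subset[OF b_deriv_cont]) auto
  qed (use assms in auto)
  have q: "q_eps M Y T \<epsilon> \<xi> \<eta> = - \<epsilon> * ln (exceedance \<xi> \<eta>)" for \<xi> \<eta>
    unfolding q_eps_def by (simp add: u_eps_eq_exceedance[OF Y])
  have shift: "g differentiable (at a) \<and> deriv g a = deriv (\<lambda>h. g (a + h)) 0"
    if "(\<lambda>h. g (a + h)) differentiable (at 0)" for g :: "real \<Rightarrow> real" and a
  proof -
    from that have "((\<lambda>h. g (a + h)) has_real_derivative deriv (\<lambda>h. g (a + h)) 0) (at 0)"
      by (simp add: DERIV_deriv_iff_real_differentiable)
    hence "(g has_real_derivative deriv (\<lambda>h. g (a + h)) 0) (at a)"
      using DERIV_shift[of g _ 0 a] by (simp add: add.commute)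
    thus ?thesis by (auto simp: real_differentiable_def intro: DERIV_imp_deriv)
  qed
  have "(\<lambda>h. q_eps M Y T \<epsilon> (x + h) y) differentiable (at 0)"
    "\<bar>deriv (\<lambda>h. q_eps M Y T \<epsilon> (x + h) y) 0\<bar> \<le> (1 + (T - t) * A) * sqrt (2
      * q_eps M Y T \<epsilon> x y / (T - t))"
    using rate_derivative_bound[of 1 0 x y] by (simp_all add: q)
  moreover have "(\<lambda>h. q_eps M Y T \<epsilon> x (y + h)) differentiable (at 0)"
    "\<bar>deriv (\<lambda>h. q_eps M Y T \<epsilon> x (y + h)) 0\<bar> \<le> (1 + (T - t) * A) * sqrt (2
      * q_eps M Y T \<epsilon> x y / (T - t))"
    using rate_derivative_bound[of 0 1 x y] by (simp_all add: q)
  ultimately show ?thesis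
    using shift[of "\<lambda>\<xi>. q_eps M Y T \<epsilon> \<xi> y" x] shift[of "\<lambda>\<eta>. q_eps M Y T \<epsilon> x \<eta>" y] by simp
qed

end
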